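(* Let $(X,\star)$ be a finite spindle with a right projector $p_0$ (i.e. $x\star p_0=p_0$ for all $x\in X$) and a right unit $u$ (i.e. $x\star u=x$ for all $x\in X$). Consider the three-term chain complex $C(X)$ for integer scalars $(a,b,d)$ and put $g=\gcd(a,b)$ and $\Sigma=a+b+d$. Let $r_{n,k}=\frac{1}{1+k}\big(k^{n+1}+(-1)^n\big)$ and let $p(n)\in\{0,1\}$ be the parity of $n$ ($p(n)=1$ iff $n$ is odd). Then for every $n\ge0$ $$ H_n(X,p_0)\cong\begin{cases} \mathbb Z^{|X|^{n+1}-1}, & \Sigma=0,\ g=0,\\ \mathbb Z^{|X|^n(|X|-1)}\oplus\mathbb Z_\Sigma^{r_{n,|X|}-p(n+1)}, & \Sigma\ne0,\ g=0,\\ \mathbb Z_g^{(|X|-1)r_{n,|X|}}\oplus\mathbb Z_{\gcd(a,b,d)}^{r_{n,|X|}-p(n+1)}, & \Sigma=0,\ g\ne0,\\ \mathbb Z_g^{(|X|-1)r_{n,|X|}}\oplus\mathbb Z_{\gcd(a,b,d)}^{r_{n,|X|}-p(n+1)}, & \Sigma\ne0,\ g\ne0. \end{cases} $$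
   Context: A spindle $(X,\star)$ is a set with a binary operation that is right self-distributive, $(x\star y)\star z=(x\star z)\star(y\star z)$, and idempotent, $x\star x=x$. The three-term chain complex $C(X)$ for integer scalars $(a,b,d)$ uses the operations $x\vdash y:=x$, $\star$, and $x\dashv y:=y$: $C_n(X)=\mathbb ZX^{n+1}$ for $n\ge 0$ (zero for $n<0$) and $\partial=a\,\partial^{\vdash}+b\,\partial^{\star}+d\,\partial^{\dashv}$, where for a binary operation $*$: $\partial^*_n=\sum_{i=0}^n(-1)^id_i^*$ for $n\ge1$, $\partial_0=0$, $d_0^*(x_0,\dots,x_n)=(x_1,\dots,x_n)$, and $d_i^*(x_0,\dots,x_n)=(x_0*x_i,\dots,x_{i-1}*x_i,x_{i+1},\dots,x_n)$ for $i\ge1$. For $t\in X$, $C(\{t\})\subset C(X)$ is the subcomplex spanned by tuples $(t,\dots,t)$, $C(X,t):=C(X)/C(\{t\})$, and $H_n(X,t)$ is its homology. $\mathbb Z_m=\mathbb Z/m\mathbb Z$. *)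

theory Defs
  imports Complex_Main "HOL-Algebra.Free_Abelian_Groups"
begin

section \<open>Spindles\<close>

locale spindle =
  fixes X :: "'a set" and star :: "'a \<Rightarrow> 'a \<Rightarrow> 'a" (infixl "\<star>" 70)
  assumes closed: "\<lbrakk>x \<in> X; y \<in> X\<rbrakk> \<Longrightarrow> x \<star> y \<in> X"
    and right_self_distributive:
      "\<lbrakk>x \<in> X; y \<in> X; z \<in> X\<rbrakk> \<Longrightarrow> (x \<star> y) \<star> z = (x \<star> z) \<star> (y \<star> z)"
    and idempotent: "x \<in> X \<Longrightarrow> x \<star> x = x"

section \<open>The three-term chain complex\<close>

text \<open>A tuple \<open>(x\<^sub>0, \<dots>, x\<^sub>n)\<close> is the list \<open>[x\<^sub>0, \<dots>, x\<^sub>n]\<close>.\<close>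

definition tuple_chains :: "'a set \<Rightarrow> nat \<Rightarrow> ('a list \<Rightarrow>\<^sub>0 int) monoid" where
  "tuple_chains X n = free_Abelian_group {xs. length xs = n + 1 \<and> set xs \<subseteq> X}"

text \<open>For \<open>i = 0\<close> this drops \<open>x\<^sub>0\<close>, whatever the operation.\<close>

definition face_map :: "('a \<Rightarrow> 'a \<Rightarrow> 'a) \<Rightarrow> nat \<Rightarrow> 'a list \<Rightarrow> 'a list" where
  "face_map f i xs = map (\<lambda>x. f x (xs ! i)) (take i xs) @ drop (Suc i) xs"

definition one_term_boundary ::
    "('a \<Rightarrow> 'a \<Rightarrow> 'a) \<Rightarrow> nat \<Rightarrow> ('a list \<Rightarrow>\<^sub>0 int) \<Rightarrow> ('a list \<Rightarrow>\<^sub>0 int)" where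
  "one_term_boundary f n c =
     (if n = 0 then 0
      else frag_extend (\<lambda>xs. \<Sum>i = 0..n. frag_cmul ((-1) ^ i) (frag_of (face_map f i xs))) c)"

definition three_term_boundary ::
    "('a \<Rightarrow> 'a \<Rightarrow> 'a) \<Rightarrow> int \<Rightarrow> int \<Rightarrow> int \<Rightarrow> nat \<Rightarrow> ('a list \<Rightarrow>\<^sub>0 int) \<Rightarrow> ('a list \<Rightarrow>\<^sub>0 int)" where
  "three_term_boundary star a b d n c =
     frag_cmul a (one_term_boundary (\<lambda>x y. x) n c)
   + frag_cmul b (one_term_boundary star n c)
   + frag_cmul d (one_term_boundary (\<lambda>x y. y) n c)"

section \<open>The quotient complex \<open>C(X)/C({t})\<close> and its homology\<close>

definition relative_chains :: "'a set \<Rightarrow> 'a \<Rightarrow> nat \<Rightarrow> ('a list \<Rightarrow>\<^sub>0 int) set monoid" where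
  "relative_chains X t n = tuple_chains X n Mod carrier (tuple_chains {t} n)"

text \<open>
  The map induced by the boundary on cosets, sending \<open>c + C\<^sub>n({t})\<close> to
  \<open>\<partial> c + C\<^sub>n\<^sub>-\<^sub>1({t})\<close> (see \<open>relative_boundary_coset\<close>). In degree \<open>0\<close> it is the zero map; its
  codomain is then \<open>C\<^sub>0\<close> instead of the zero group, because \<open>n - 1\<close> truncates. This does not
  affect its kernel.
\<close>

definition relative_boundary ::
    "('a \<Rightarrow> 'a \<Rightarrow> 'a) \<Rightarrow> int \<Rightarrow> int \<Rightarrow> int \<Rightarrow> 'a set \<Rightarrow> 'a \<Rightarrow> nat
      \<Rightarrow> ('a list \<Rightarrow>\<^sub>0 int) set \<Rightarrow> ('a list \<Rightarrow>\<^sub>0 int) set" where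
  "relative_boundary star a b d X t n A =
     carrier (tuple_chains {t} (n - 1))
       <#>\<^bsub>tuple_chains X (n - 1)\<^esub> three_term_boundary star a b d n ` A"

definition relative_homology ::
    "('a \<Rightarrow> 'a \<Rightarrow> 'a) \<Rightarrow> int \<Rightarrow> int \<Rightarrow> int \<Rightarrow> 'a set \<Rightarrow> 'a \<Rightarrow> nat
      \<Rightarrow> ('a list \<Rightarrow>\<^sub>0 int) set set monoid" where
  "relative_homology star a b d X t n =
     (relative_chains X t n)
       \<lparr>carrier := kernel (relative_chains X t n) (relative_chains X t (n - 1))
                     (relative_boundary star a b d X t n)\<rparr>
     Mod (relative_boundary star a b d X t (Suc n) ` carrier (relative_chains X t (Suc n)))"

section \<open>The groups and exponents in the answer\<close>

text \<open>\<open>\<int>/m\<int>\<close>, also for negative \<open>m\<close>.\<close>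

definition Zmod :: "int \<Rightarrow> int monoid" where
  "Zmod m = integer_mod_group (nat \<bar>m\<bar>)"

definition group_power :: "('g, 'm) monoid_scheme \<Rightarrow> nat \<Rightarrow> (nat \<Rightarrow> 'g) monoid" where
  "group_power G m = product_group {..<m} (\<lambda>_. G)"

text \<open>The division is exact and the result is nonnegative, see \<open>of_nat_r_exponent\<close>.\<close>

definition r_exponent :: "nat \<Rightarrow> nat \<Rightarrow> nat" where
  "r_exponent n k = nat ((int k ^ (n + 1) + (-1) ^ n) div (1 + int k))"

section \<open>Adequacy of the encodings\<close>

lemma r_exponent_dvd: "(1 + int k) dvd (int k ^ (n + 1) + (-1) ^ n)"
proof (induction n)
  case (Suc n)
  have "int k ^ (Suc n + 1) + (-1) ^ Suc n
      = int k * (int k ^ (n + 1) + (-1) ^ n) + (1 + int k) * (- ((-1) ^ n))"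
    by (simp add: algebra_simps)
  then show ?case
    using Suc by simp
qed (simp add: add.commute)

lemma of_nat_r_exponent:
  assumes "k \<ge> 1"
  shows "(of_nat (r_exponent n k) :: rat) = 1 / (1 + of_nat k) * (of_nat k ^ (n + 1) + (-1) ^ n)"
proof -
  obtain q where q: "int k ^ (n + 1) + (-1) ^ n = (1 + int k) * q"
    using r_exponent_dvd[of k n] by (auto elim: dvdE)
  have "int k ^ (n + 1) \<ge> 1"
    using assms by (intro one_le_power) simp
  moreover have "(-1 :: int) \<le> (-1) ^ n"
    by (cases "even n") auto
  ultimately have "0 \<le> (1 + int k) * q"
    using q by linarith
  then have "q \<ge> 0"
    by (simp add: zero_le_mult_iff)
  moreover have "r_exponent n k = nat q"
    unfolding r_exponent_def q by simp
  ultimately have r: "(of_nat (r_exponent n k) :: rat) = of_int q"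
    by simp
  have "(of_nat k ^ (n + 1) + (-1) ^ n :: rat) = of_int (int k ^ (n + 1) + (-1) ^ n)"
    by simp
  also have "\<dots> = (1 + of_nat k) * of_int q"
    unfolding q by simp
  finally have e: "(of_nat k ^ (n + 1) + (-1) ^ n :: rat) = (1 + of_nat k) * of_int q" .
  have "(1 + of_nat k :: rat) \<noteq> 0"
    using of_nat_neq_0[of k, where 'a = rat] by simp
  then show ?thesis
    unfolding r e by simp
qed

lemma of_bool_le_r_exponent:
  assumes "k \<ge> 1"
  shows "of_bool (odd (n + 1)) \<le> r_exponent n k"
proof (cases "even n")
  case True
  have "(0 :: rat) < of_nat k ^ (n + 1) + 1" "(0 :: rat) < 1 + of_nat k"
    using assms by (auto intro!: add_pos_pos)
  then have "(of_nat (r_exponent n k) :: rat) > 0"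
    using True by (simp add: of_nat_r_exponent[OF assms] del: power_Suc)
  then have "r_exponent n k \<noteq> 0"
    by simp
  then show ?thesis
    by simp
qed simp

lemma one_term_boundary_add:
  "one_term_boundary f n (c + c') = one_term_boundary f n c + one_term_boundary f n c'"
  by (simp add: one_term_boundary_def frag_extend_add)

lemma three_term_boundary_add:
  "three_term_boundary star a b d n (c + c')
     = three_term_boundary star a b d n c + three_term_boundary star a b d n c'"
  by (simp add: three_term_boundary_def one_term_boundary_add frag_cmul_distrib2 algebra_simps)

lemma one_term_boundary_closed:
  assumes f: "\<And>x y. \<lbrakk>x \<in> X; y \<in> X\<rbrakk> \<Longrightarrow> f x y \<in> X"
    and c: "c \<in> carrier (tuple_chains X n)"
  shows "one_term_boundary f n c \<in> carrier (tuple_chains X (n - 1))"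
proof (cases "n = 0")
  case False
  have "Poly_Mapping.keys (frag_extend
          (\<lambda>xs. \<Sum>i = 0..n. frag_cmul ((-1) ^ i) (frag_of (face_map f i xs))) c)
        \<subseteq> {xs. length xs = n \<and> set xs \<subseteq> X}"
  proof (rule order_trans[OF keys_frag_extend], rule UN_least)
    fix xs assume "xs \<in> Poly_Mapping.keys c"
    then have xs: "length xs = n + 1" "set xs \<subseteq> X"
      using c by (auto simp: tuple_chains_def free_Abelian_group_def)
    show "Poly_Mapping.keys (\<Sum>i = 0..n. frag_cmul ((-1) ^ i) (frag_of (face_map f i xs)))
        \<subseteq> {xs. length xs = n \<and> set xs \<subseteq> X}"
    proof (rule order_trans[OF keys_sum], rule UN_least)
      fix i assume i: "i \<in> {0..n}"
      have "length (face_map f i xs) = n"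
        using i xs by (simp add: face_map_def)
      moreover have "set (face_map f i xs) \<subseteq> X"
        using i xs by (auto simp: face_map_def intro!: f dest: in_set_takeD in_set_dropD)
      ultimately show "Poly_Mapping.keys (frag_cmul ((-1) ^ i) (frag_of (face_map f i xs)))
        \<subseteq> {xs. length xs = n \<and> set xs \<subseteq> X}"
        using keys_cmul[of "(-1) ^ i" "frag_of (face_map f i xs)"] by auto
    qed
  qed
  then show ?thesis
    using False by (simp add: one_term_boundary_def tuple_chains_def free_Abelian_group_def)
qed (simp add: one_term_boundary_def tuple_chains_def free_Abelian_group_def)

lemma three_term_boundary_closed:
  assumes f: "\<And>x y. \<lbrakk>x \<in> X; y \<in> X\<rbrakk> \<Longrightarrow> star x y \<in> X"
    and c: "c \<in> carrier (tuple_chains X n)"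
  shows "three_term_boundary star a b d n c \<in> carrier (tuple_chains X (n - 1))"
proof -
  have cl: "frag_cmul m x + y \<in> carrier (tuple_chains X k)"
    if "x \<in> carrier (tuple_chains X k)" "y \<in> carrier (tuple_chains X k)" for m x y k
    using that keys_cmul[of m x] Poly_Mapping.keys_add[of "frag_cmul m x" y]
    unfolding tuple_chains_def free_Abelian_group_def partial_object.simps mem_Collect_eq
    by blast
  have z: "0 \<in> carrier (tuple_chains X (n - 1))"
    by (simp add: tuple_chains_def free_Abelian_group_def)
  note o = one_term_boundary_closed[OF _ c]
  have "frag_cmul a (one_term_boundary (\<lambda>x y. x) n c)
      + (frag_cmul b (one_term_boundary star n c)
      + (frag_cmul d (one_term_boundary (\<lambda>x y. y) n c) + 0)) \<in> carrier (tuple_chains X (n - 1))"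
    by (intro cl o z) (auto intro: f)
  then show ?thesis
    by (simp add: three_term_boundary_def add.assoc)
qed

text \<open>On cosets, the induced map is given by the boundary of any representative.\<close>

lemma relative_boundary_coset:
  assumes "star t t = t"
  shows "relative_boundary star a b d X t n
           (carrier (tuple_chains {t} n) #>\<^bsub>tuple_chains X n\<^esub> c)
       = carrier (tuple_chains {t} (n - 1))
           #>\<^bsub>tuple_chains X (n - 1)\<^esub> three_term_boundary star a b d n c"
proof -
  have m: "mult (tuple_chains X k) = (+)" for k
    by (simp add: tuple_chains_def free_Abelian_group_def)
  have z: "0 \<in> carrier (tuple_chains {t} k)" for k
    by (simp add: tuple_chains_def free_Abelian_group_def)
  have pl: "x + y \<in> carrier (tuple_chains {t} k)"
    if "x \<in> carrier (tuple_chains {t} k)" "y \<in> carrier (tuple_chains {t} k)" for x y k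
    using that Poly_Mapping.keys_add[of x y]
    unfolding tuple_chains_def free_Abelian_group_def partial_object.simps mem_Collect_eq
    by blast
  have cl: "three_term_boundary star a b d n h \<in> carrier (tuple_chains {t} (n - 1))"
    if "h \<in> carrier (tuple_chains {t} n)" for h
    using that assms by (intro three_term_boundary_closed) auto
  show ?thesis
  proof (intro Set.set_eqI iffI)
    fix y
    assume "y \<in> relative_boundary star a b d X t n
                  (carrier (tuple_chains {t} n) #>\<^bsub>tuple_chains X n\<^esub> c)"
    then obtain h h' where h: "h \<in> carrier (tuple_chains {t} (n - 1))"
        "h' \<in> carrier (tuple_chains {t} n)" "y = h + three_term_boundary star a b d n (h' + c)"
      unfolding relative_boundary_def set_mult_def r_coset_def m by blast
    have "y = (h + three_term_boundary star a b d n h') + three_term_boundary star a b d n c"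
      using h(3) by (simp add: three_term_boundary_add add.assoc)
    then show "y \<in> carrier (tuple_chains {t} (n - 1))
                 #>\<^bsub>tuple_chains X (n - 1)\<^esub> three_term_boundary star a b d n c"
      unfolding r_coset_def m using pl[OF h(1) cl[OF h(2)]] by blast
  next
    fix y
    assume "y \<in> carrier (tuple_chains {t} (n - 1))
                 #>\<^bsub>tuple_chains X (n - 1)\<^esub> three_term_boundary star a b d n c"
    then obtain h where h: "h \<in> carrier (tuple_chains {t} (n - 1))"
        "y = h + three_term_boundary star a b d n (0 + c)"
      unfolding r_coset_def m by auto
    then show "y \<in> relative_boundary star a b d X t n
                  (carrier (tuple_chains {t} n) #>\<^bsub>tuple_chains X n\<^esub> c)"
      unfolding relative_boundary_def set_mult_def r_coset_def m using z[of n] by blast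
  qed
qed

end

theory Submission
  imports Defs
begin

text \<open>
  \<^bold>\<open>Reduction.\<close> Collapsing every tuple to \<open>(p\<^sub>0, \<dots>, p\<^sub>0)\<close> retracts the complex onto \<open>C({p\<^sub>0})\<close>, so
  \<open>C(X, p\<^sub>0)\<close> is isomorphic to the subcomplex of \<^emph>\<open>reduced\<close> chains, those that the collapse kills. Let
  \<open>\<partial>\<^sub>L\<close>, \<open>\<partial>\<^sub>S\<close>, \<open>\<partial>\<^sub>R\<close> be the one-term boundaries of \<open>x \<turnstile> y = x\<close>, of \<open>\<star>\<close> and of \<open>x \<stileturn> y = y\<close>. They square to
  zero and anticommute pairwise.

  \<^bold>\<open>Contractions.\<close> Appending \<open>y\<close> to a tuple, with the sign \<open>(-1)\<^bsup>length\<^esup>\<close>, is an operator \<open>s\<^sub>y\<close> with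
  \<open>\<partial> s\<^sub>y + s\<^sub>y \<partial> = (x\<^sub>0 * y, \<dots>, x\<^sub>n * y)\<close> for the boundary of any operation \<open>*\<close> (\<open>boundary_append\<close>). Sending all
  tuples to a constant one is zero on reduced chains. Hence \<open>s\<^sub>p\<close> with \<open>p = p\<^sub>0\<close> contracts \<open>\<partial>\<^sub>L\<close> and anticommutes with \<open>\<partial>\<^sub>S\<close>
  and \<open>\<partial>\<^sub>R\<close>, while \<open>s\<^sub>u - s\<^sub>p\<close> contracts \<open>\<partial>\<^sub>S\<close> and anticommutes with the other two. If \<open>g = gcd a b\<close> is
  nonzero and \<open>\<alpha> a + \<beta> b = g\<close>, then \<open>\<delta> = (a/g) \<partial>\<^sub>L + (b/g) \<partial>\<^sub>S\<close> is contracted by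
  \<open>s = \<alpha> s\<^sub>p + \<beta> (s\<^sub>u - s\<^sub>p)\<close>, \<open>s\<close> anticommutes with \<open>\<partial>\<^sub>R\<close>, and the total boundary is \<open>g \<delta> + d \<partial>\<^sub>R\<close>
  (\<open>contracted_complex_reduced\<close>).

  \<^bold>\<open>Splitting.\<close> With \<open>K = ker \<delta>\<close> the reduced complex is \<open>K \<oplus> s K\<close>, the mapping cone of multiplication by
  \<open>g\<close> on \<open>(K, d \<partial>\<^sub>R)\<close>. The operator \<open>q\<close> that doubles the first entry satisfies
  \<open>\<partial>\<^sub>R q \<partial>\<^sub>R = \<partial>\<^sub>R\<close> (\<open>D_q_D\<close>), so the image of \<open>\<partial>\<^sub>R\<close> is a direct summand, and the same holds on \<open>K\<close>.
  Therefore \<open>K\<close> has a basis \<open>W \<union> T \<union> U\<close> in which \<open>T\<close> is a basis of the image of \<open>\<partial>\<^sub>R\<close>, \<open>W \<union> T\<close> one of its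
  kernel, and \<open>\<partial>\<^sub>R\<close> is injective on the span of \<open>U\<close>. An element of \<open>W\<close> yields a summand \<open>\<int>\<^sub>g\<close> of the
  homology, and an element of \<open>T\<close> or \<open>U\<close> a summand \<open>\<int>\<^bsub>gcd(g,d)\<^esub>\<close> (\<open>total_cycles_basis\<close>). If \<open>g = 0\<close>, the boundary
  is \<open>d \<partial>\<^sub>R\<close>, and the splitting of the reduced complex itself gives the answer.

  \<^bold>\<open>Counting.\<close> What remains are ranks. In tuple length \<open>l\<close> the reduced chains have rank \<open>|X|\<^bsup>l\<^esup> - 1\<close>. The
  ranks of the images of \<open>\<partial>\<^sub>R\<close> in two consecutive degrees, and the ranks of two consecutive \<open>K\<close>, add up to
  such numbers (\<open>rank_D_image_add\<close>, \<open>rank_K_add\<close>). These are the recursion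
  \<open>r\<^bsub>n+1,k\<^esub> + r\<^bsub>n,k\<^esub> = k\<^bsup>n+1\<^esup>\<close> up to the parity term. No rank depends on \<open>\<star>\<close>, and hence the homology depends
  only on the scalars and the cardinality of \<open>X\<close>.
\<close>

section \<open>Finitely generated free abelian groups\<close>

text \<open>
  All chain groups of a complex of tuples live in one abelian group, of which the individual degrees are
  subgroups. Working with subgroups of a fixed \<open>\<int>\<close>-module makes the linear algebra over a commutative
  ring available: \<open>subspace\<close> is subgroup, and \<open>independent\<close> means linearly independent over \<open>\<int>\<close>.
\<close>

locale torsion_free_int_module = module scale
  for scale :: "int \<Rightarrow> 'b::ab_group_add \<Rightarrow> 'b" (infixr \<open>*s\<close> 75) +
  assumes scale_eq_0D: "m *s x = 0 \<Longrightarrow> m \<noteq> 0 \<Longrightarrow> x = 0"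
begin

abbreviation linear_map :: "('b \<Rightarrow> 'b) \<Rightarrow> bool" where
  "linear_map \<equiv> module_hom scale scale"

definition basis_of :: "'b set \<Rightarrow> 'b set \<Rightarrow> bool" where
  "basis_of S B \<longleftrightarrow> finite B \<and> independent B \<and> span B = S"

definition rank :: "'b set \<Rightarrow> nat" where
  "rank S = card (SOME B. basis_of S B)"

lemma subspace_basis_of: "basis_of S B \<Longrightarrow> subspace S"
  by (auto simp: basis_of_def)

lemma basis_of_subset: "basis_of S B \<Longrightarrow> B \<subseteq> S"
  using span_superset unfolding basis_of_def by blast

lemma independentI_finite:
  assumes "finite B" "\<And>c. (\<Sum>v\<in>B. c v *s v) = 0 \<Longrightarrow> \<forall>v\<in>B. c v = 0"
  shows "independent B"
  using assms dependent_finite by blast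

lemma independent_UnI:
  assumes f: "linear_map f" and K: "finite K" "independent K" "\<And>x. x \<in> K \<Longrightarrow> f x = 0"
    and U: "finite U" "inj_on f U" "independent (f ` U)"
  shows "independent (K \<union> U)" "K \<inter> U = {}"
proof -
  interpret f: module_hom scale scale f by fact
  have "0 \<notin> f ` U"
    using U(3) dependent_zero by blast
  then show disj: "K \<inter> U = {}"
    using K(3) by (metis disjoint_iff imageI)
  show "independent (K \<union> U)"
  proof (rule independentI_finite)
    show "finite (K \<union> U)" using K U by simp
    fix c assume c: "(\<Sum>v\<in>K \<union> U. c v *s v) = 0"
    then have split: "(\<Sum>v\<in>K. c v *s v) + (\<Sum>v\<in>U. c v *s v) = 0"
      using disj K(1) U(1) by (simp add: sum.union_disjoint)
    have "f ((\<Sum>v\<in>K. c v *s v) + (\<Sum>v\<in>U. c v *s v)) = (\<Sum>v\<in>U. c v *s f v)"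
      using K(3) by (simp add: f.add f.sum f.scale)
    also have "\<dots> = (\<Sum>w\<in>f ` U. c (the_inv_into U f w) *s w)"
      using U(2) by (simp add: sum.reindex the_inv_into_f_f cong: sum.cong)
    finally have "(\<Sum>w\<in>f ` U. c (the_inv_into U f w) *s w) = 0"
      using split f.zero by simp
    then have cU: "c v = 0" if "v \<in> U" for v
      using independentD[OF U(3), of "f ` U" "\<lambda>w. c (the_inv_into U f w)" "f v"] that U(1,2)
      by (simp add: the_inv_into_f_f)
    then have "(\<Sum>v\<in>K. c v *s v) = 0"
      using split by simp
    then have "c v = 0" if "v \<in> K" for v
      using independentD[OF K(2) K(1)] that by blast
    with cU show "\<forall>v\<in>K \<union> U. c v = 0" by blast
  qed
qed

text \<open>
  Over \<open>\<int>\<close> it is not enough that \<open>v\<close> itself lies outside the span: no nonzero multiple may lie in it.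
\<close>

lemma independent_insertI:
  assumes A: "finite A" "independent A" and v: "\<And>c. c *s v \<in> span A \<Longrightarrow> c = 0"
  shows "independent (insert v A)"
proof (rule independentI_finite)
  have "v \<notin> A"
    using v[of 1] span_base by auto
  fix c assume "(\<Sum>w\<in>insert v A. c w *s w) = 0"
  then have eq: "c v *s v + (\<Sum>w\<in>A. c w *s w) = 0"
    using A \<open>v \<notin> A\<close> by simp
  have "(- c v) *s v \<in> span A"
  proof -
    have "(- c v) *s v = (\<Sum>w\<in>A. c w *s w)"
      using eq by (simp add: neg_eq_iff_add_eq_0)
    then show ?thesis
      by (simp only:) (intro span_sum span_scale span_base)
  qed
  then have "c v = 0"
    using v by fastforce
  moreover from this have "\<forall>w\<in>A. c w = 0"
    using eq independentD[OF A(2) A(1)] by simp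
  ultimately show "\<forall>w\<in>insert v A. c w = 0"
    by simp
qed (use A in simp)

text \<open>
  A subgroup of a finitely generated free abelian group is again free. By induction on the basis
  \<open>insert b B\<close>: the coefficients at \<open>b\<close> that occur in the subgroup form an ideal of \<open>\<int>\<close>, and an
  element realising the positive generator of that ideal complements the part inside \<open>span B\<close>.
\<close>

lemma subspace_has_basis:
  assumes "finite B" "independent B" "subspace S" "S \<subseteq> span B"
  shows "\<exists>A. basis_of S A"
  using assms
proof (induction B arbitrary: S rule: finite_induct)
  case empty
  then have "S = {0}"
    using subspace_0 by auto
  then show ?case
    using independent_empty unfolding basis_of_def by (intro exI[of _ "{}"]) auto
next
  case (insert b B)
  have indB: "independent B"
    using insert.prems(1) independent_mono by blast
  obtain A where A: "basis_of (S \<inter> span B) A"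
    using insert.IH[OF indB, of "S \<inter> span B"] insert.prems(2) subspace_inter by blast
  have b0: "c = 0" if "c *s b \<in> span B" for c
  proof -
    obtain r where r: "c *s b = (\<Sum>v\<in>B. r v *s v)"
      using \<open>c *s b \<in> span B\<close> span_finite[OF insert.hyps(1)] by auto
    define r' where "r' = (\<lambda>v. if v = b then - c else r v)"
    have "(\<Sum>v\<in>insert b B. r' v *s v) = (- c) *s b + (\<Sum>v\<in>B. r v *s v)"
      using insert.hyps by (auto simp: r'_def intro!: sum.cong)
    also have "\<dots> = 0"
      using r by simp
    finally have "r' b = 0"
      using independentD[OF insert.prems(1)] insert.hyps by blast
    then show "c = 0" by (simp add: r'_def)
  qed
  define P where "P k \<longleftrightarrow> (\<exists>x\<in>S. x - int k *s b \<in> span B)" for k :: nat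
  show ?case
  proof (cases "\<exists>k>0. P k")
    case False
    have "S \<subseteq> span B"
    proof
      fix x assume x: "x \<in> S"
      then obtain k where k: "x - k *s b \<in> span B"
        using insert.prems(3) span_insert by auto
      have "k = 0"
      proof (rule ccontr)
        assume "k \<noteq> 0"
        have "- x \<in> S" using x insert.prems(2) subspace_neg by blast
        moreover have "- x - (- k) *s b \<in> span B"
          using span_neg[OF k] by simp
        ultimately have "P (nat \<bar>k\<bar>)"
          using x k unfolding P_def
          by (cases "k \<ge> 0") (auto intro: bexI[of _ x] bexI[of _ "- x"])
        moreover have "nat \<bar>k\<bar> > 0" using \<open>k \<noteq> 0\<close> by simp
        ultimately show False using False by blast
      qed
      then show "x \<in> span B" using k by simp
    qed
    then show ?thesis using A by (metis inf.absorb1)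
  next
    case True
    \<comment> \<open>The positive generator of the ideal of coefficients at \<open>b\<close>.\<close>
    define m where "m = (LEAST k. k > 0 \<and> P k)"
    have m: "m > 0" "P m"
      using LeastI_ex[OF True] by (auto simp: m_def)
    obtain v where v: "v \<in> S" "v - int m *s b \<in> span B"
      using m(2) P_def by blast
    have red: "\<exists>q. x - q *s v \<in> S \<inter> span B" if x: "x \<in> S" for x
    proof -
      obtain k where k: "x - k *s b \<in> span B"
        using insert.prems(3) span_insert x by auto
      define q r where "q = k div int m" and "r = k mod int m"
      have kq: "k = q * int m + r" by (simp add: q_def r_def)
      have r: "0 \<le> r" "r < int m" using m by (auto simp: r_def)
      have S: "x - q *s v \<in> S"
        using x v insert.prems(2) by (simp add: subspace_diff subspace_scale)
      have "x - q *s v - r *s b = (x - k *s b) - q *s (v - int m *s b)"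
        by (simp add: kq algebra_simps)
      also have "\<dots> \<in> span B"
        using k v(2) span_diff span_scale by blast
      finally have *: "x - q *s v - r *s b \<in> span B" .
      then have "P (nat r)"
        using S r(1) P_def by auto
      then have "nat r = 0"
        using not_less_Least[of "nat r" "\<lambda>k. k > 0 \<and> P k"] r m_def
        by (metis gr0I nat_less_iff)
      then have "r = 0" using r by simp
      then show ?thesis using S * by auto
    qed
    have v0: "c = 0" if "c *s v \<in> span A" for c
    proof -
      have "c *s v \<in> span B"
        using that A by (simp add: basis_of_def)
      moreover have "c *s (v - int m *s b) \<in> span B"
        using v(2) span_scale by blast
      ultimately have "c *s v - c *s (v - int m *s b) \<in> span B"
        by (rule span_diff)
      then have "(c * int m) *s b \<in> span B"
        by (simp add: algebra_simps)
      then show ?thesis using b0 m(1) by fastforce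
    qed
    have "basis_of S (insert v A)"
      unfolding basis_of_def
    proof (intro conjI)
      show "finite (insert v A)"
        using A by (simp add: basis_of_def)
      show "independent (insert v A)"
        by (rule independent_insertI) (use A v0 in \<open>simp_all add: basis_of_def\<close>)
      have "insert v A \<subseteq> S"
        using A v(1) span_superset[of A] by (auto simp: basis_of_def)
      moreover have "S \<subseteq> span (insert v A)"
        using red A by (auto simp: span_insert basis_of_def)
      ultimately show "span (insert v A) = S"
        using insert.prems(2) span_subspace by blast
    qed
    then show ?thesis by blast
  qed
qed

lemma representation_sum_subset:
  assumes "finite B" "independent B" "T \<subseteq> B" "b \<in> B"
  shows "representation B (\<Sum>T) b = of_bool (b \<in> T)"
proof -
  have fT: "finite T" using assms finite_subset by blast
  have "representation B (\<Sum>T) = (\<lambda>b. \<Sum>v\<in>T. representation B v b)"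
    using representation_sum[OF assms(2), of T "\<lambda>v. v"] assms(3) span_base by auto
  also have "\<dots> = (\<lambda>b. \<Sum>v\<in>T. if b = v then 1 else 0)"
    using assms(2,3) by (intro ext sum.cong) (auto simp: representation_basis)
  finally show ?thesis
    using fT by (simp add: of_bool_def)
qed

text \<open>
  The rank is well defined since \<open>S/2S\<close> has \<open>2\<^bsup>rank\<^esup>\<close> elements: a subset of one basis is determined
  by the parities of the coefficients of its sum with respect to the other basis.
\<close>

lemma basis_card_le:
  assumes A: "basis_of S A" and B: "basis_of S B"
  shows "card A \<le> card B"
proof -
  have fin: "finite A" "finite B" and ind: "independent A" "independent B"
    and sp: "span A = S" "span B = S"
    using A B by (auto simp: basis_of_def)
  define \<phi> where "\<phi> T = {b \<in> B. odd (representation B (\<Sum>T) b)}" for T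
  have "inj_on \<phi> (Pow A)"
  proof (rule inj_onI)
    fix T T' assume T: "T \<in> Pow A" "T' \<in> Pow A" and eq: "\<phi> T = \<phi> T'"
    define r where "r b = representation B (\<Sum>T) b - representation B (\<Sum>T') b" for b
    have inS: "\<Sum>T \<in> S" "\<Sum>T' \<in> S"
      using T sp(1) span_base by (auto intro!: span_sum simp flip: sp(1))
    define z where "z = (\<Sum>b\<in>B. (r b div 2) *s b)"
    have "even (r b)" if "b \<in> B" for b
      using eq that unfolding \<phi>_def r_def by (auto simp: set_eq_iff)
    then have "2 *s z = (\<Sum>b\<in>B. r b *s b)"
      by (simp add: z_def scale_sum_right)
    also have "\<dots> = \<Sum>T - \<Sum>T'"
      unfolding r_def using inS ind(2) fin(2) sp(2)
      by (simp add: scale_left_diff_distrib sum_subtractf sum_representation_eq)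
    finally have z2: "2 *s z = \<Sum>T - \<Sum>T'" .
    have zS: "z \<in> span A"
      unfolding z_def sp(1) sp(2)[symmetric] by (intro span_sum span_scale span_base)
    have "(of_bool (x \<in> T) :: int) - of_bool (x \<in> T') = 2 * representation A z x" if "x \<in> A" for x
    proof -
      have "representation A (\<Sum>T - \<Sum>T') x = representation A (\<Sum>T) x - representation A (\<Sum>T') x"
        using representation_diff[OF ind(1)] inS sp(1) by simp
      moreover have "representation A (2 *s z) x = 2 * representation A z x"
        using representation_scale[OF ind(1) zS] by simp
      ultimately show ?thesis
        using representation_sum_subset[OF fin(1) ind(1)] T that z2 by simp
    qed
    then have "(of_bool (x \<in> T) :: int) - of_bool (x \<in> T') \<noteq> 1 \<and>
        (of_bool (x \<in> T) :: int) - of_bool (x \<in> T') \<noteq> - 1" if "x \<in> A" for x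
      using that by presburger
    then have "x \<in> T \<longleftrightarrow> x \<in> T'" if "x \<in> A" for x
      using that by (smt (verit) of_bool_eq)
    then show "T = T'" using T by blast
  qed
  moreover have "\<phi> ` Pow A \<subseteq> Pow B" by (auto simp: \<phi>_def)
  ultimately have "card (Pow A) \<le> card (Pow B)"
    using card_inj_on_le fin(2) by blast
  then show ?thesis
    using fin by (simp add: card_Pow)
qed

lemma rank_eq_card: "basis_of S B \<Longrightarrow> rank S = card B"
  unfolding rank_def by (metis basis_card_le order_antisym someI)

lemma subspace_of_has_basis:
  assumes "basis_of S B" "subspace T" "T \<subseteq> S"
  shows "\<exists>A. basis_of T A"
  using assms subspace_has_basis by (auto simp: basis_of_def)

lemma rank_zero [simp]: "rank {0} = 0"
  using rank_eq_card[of "{0}" "{}"] independent_empty by (simp add: basis_of_def)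

lemma basis_of_kernel_Un_lift:
  assumes f: "linear_map f" and S: "subspace S"
    and K: "basis_of {x \<in> S. f x = 0} K" and T: "basis_of (f ` S) T"
    and U: "U \<subseteq> S" "inj_on f U" "f ` U = T"
  shows "basis_of S (K \<union> U)" "K \<inter> U = {}"
proof -
  interpret f: module_hom scale scale f by fact
  have K': "finite K" "independent K" "span K = {x \<in> S. f x = 0}"
    and T': "finite T" "independent T" "span T = f ` S"
    using K T by (auto simp: basis_of_def)
  have KS: "K \<subseteq> {x \<in> S. f x = 0}" using K'(3) span_superset by blast
  have fU: "finite U" using U(2,3) T'(1) finite_image_iff by blast
  show "K \<inter> U = {}"
    using independent_UnI(2)[OF f K'(1,2) _ fU U(2)] KS T'(2) U(3) by auto
  have "independent (K \<union> U)"
    using independent_UnI(1)[OF f K'(1,2) _ fU U(2)] KS T'(2) U(3) by auto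
  moreover have "span (K \<union> U) = S"
  proof (rule span_subspace[OF _ _ S])
    show "K \<union> U \<subseteq> S" using KS U by auto
    show "S \<subseteq> span (K \<union> U)"
    proof
      fix x assume x: "x \<in> S"
      then have "f x \<in> f ` span U"
        using T'(3) U(3) f.span_image by auto
      then obtain y where y: "y \<in> span U" "f x = f y" by blast
      have "y \<in> S" using y(1) U(1) S span_minimal by blast
      then have "x - y \<in> span K"
        using x y(2) S by (simp add: K'(3) f.diff subspace_diff)
      then have "(x - y) + y \<in> span (K \<union> U)"
        using y(1) span_Un by blast
      then show "x \<in> span (K \<union> U)" by simp
    qed
  qed
  ultimately show "basis_of S (K \<union> U)"
    using K'(1) fU by (simp add: basis_of_def)
qed

lemma image_basis_lift:
  assumes "T \<subseteq> f ` S"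
  obtains U where "U \<subseteq> S" "inj_on f U" "f ` U = T"
proof -
  obtain U where "U \<subseteq> S" "inj_on f U" "T = f ` U"
    using assms unfolding subset_image_inj by blast
  then show ?thesis using that by simp
qed

lemma subspace_kernel_in:
  "linear_map f \<Longrightarrow> subspace S \<Longrightarrow> subspace {x \<in> S. f x = 0}"
  using module_hom.subspace_kernel[of scale scale f] subspace_inter[of S "{x. f x = 0}"]
  by (simp add: Collect_conj_eq)

lemma rank_nullity:
  assumes f: "linear_map f" and A: "basis_of S A" and V: "basis_of V B" "f ` S \<subseteq> V"
  shows "rank S = rank {x \<in> S. f x = 0} + rank (f ` S)"
proof -
  interpret f: module_hom scale scale f by fact
  have S: "subspace S" using A subspace_basis_of by blast
  obtain K where K: "basis_of {x \<in> S. f x = 0} K"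
    using subspace_of_has_basis[OF A subspace_kernel_in[OF f S]] by auto
  obtain T where T: "basis_of (f ` S) T"
    using subspace_of_has_basis[OF V(1) f.subspace_image[OF S] V(2)] by auto
  have "T \<subseteq> f ` S" using T by (rule basis_of_subset)
  then obtain U where U: "U \<subseteq> S" "inj_on f U" "f ` U = T"
    by (rule image_basis_lift)
  have "finite U"
    using U(2,3) T finite_image_iff by (auto simp: basis_of_def)
  then have "card (K \<union> U) = card K + card T"
    using basis_of_kernel_Un_lift(2)[OF f S K T U] K U(2,3)
    by (auto simp: basis_of_def card_Un_disjoint card_image)
  then show ?thesis
    using rank_eq_card[OF basis_of_kernel_Un_lift(1)[OF f S K T U]] rank_eq_card[OF K]
      rank_eq_card[OF T] by simp
qed

lemma rank_inj_image:
  assumes f: "linear_map f" and A: "basis_of S A" and V: "basis_of V B" "f ` S \<subseteq> V"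
    and inj: "\<And>x. x \<in> S \<Longrightarrow> f x = 0 \<Longrightarrow> x = 0"
  shows "rank (f ` S) = rank S"
proof -
  interpret f: module_hom scale scale f by fact
  have "{x \<in> S. f x = 0} = {0}"
    using inj subspace_0[OF subspace_basis_of[OF A]] by auto
  then show ?thesis
    using rank_nullity[OF f A V] by simp
qed

text \<open>
  A basis of a subgroup does not in general extend to the whole group, since the quotient can have torsion. It does
  for the image of a retraction, and this is how bases of boundaries become parts of bases of cycles.
\<close>

lemma retract_basis_extends:
  assumes h: "linear_map h" and S: "basis_of S A" and T: "basis_of R T" "R \<subseteq> S"
    and retr: "\<And>x. x \<in> S \<Longrightarrow> h x \<in> R" "\<And>y. y \<in> R \<Longrightarrow> h y = y"
  obtains W where "basis_of S (W \<union> T)" "W \<inter> T = {}"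
proof -
  have sub: "subspace S" using S subspace_basis_of by blast
  have hS: "h ` S = R" using retr T(2) by force
  have TR: "T \<subseteq> R" using T(1) by (rule basis_of_subset)
  obtain W where W: "basis_of {x \<in> S. h x = 0} W"
    using subspace_of_has_basis[OF S subspace_kernel_in[OF h sub]] by auto
  have "inj_on h T" "h ` T = T" "T \<subseteq> S"
    using TR retr(2) T(2) by (auto simp: inj_on_def subset_iff image_iff) 
  then show ?thesis
    using basis_of_kernel_Un_lift[OF h sub W, of T T] T(1) hS that by simp
qed

lemma basis_of_scale:
  assumes "basis_of S B" "m \<noteq> 0"
  shows "basis_of ((*s) m ` S) ((*s) m ` B)"
proof -
  interpret m: module_hom scale scale "(*s) m" by simp
  have "inj_on ((*s) m) (span B)"
    using scale_eq_0D[OF _ assms(2)] m.inj_on_iff_eq_0[OF subspace_span] by blast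
  then show ?thesis
    using assms(1) m.independent_injective_image m.span_image by (auto simp: basis_of_def)
qed

end

section \<open>Quotients by multiples of a basis\<close>

definition additive_group :: "'b::ab_group_add set \<Rightarrow> 'b monoid" where
  "additive_group S = \<lparr>carrier = S, monoid.mult = (+), one = 0\<rparr>"

lemma additive_group_simps [simp]:
  "carrier (additive_group S) = S" "\<one>\<^bsub>additive_group S\<^esub> = 0"
  "x \<otimes>\<^bsub>additive_group S\<^esub> y = x + y"
  by (simp_all add: additive_group_def)

lemma carrier_Zmod: "carrier (Zmod m) = {x. x mod \<bar>m\<bar> = x}"
  by (auto simp: Zmod_def carrier_integer_mod_group intro: mod_pos_pos_trivial)
     (metis abs_ge_zero abs_of_nonneg linorder_neqE_linordered_idom mod_by_0 pos_mod_bound pos_mod_sign zero_less_abs_iff)+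

lemma one_Zmod [simp]: "\<one>\<^bsub>Zmod m\<^esub> = 0"
  by (simp add: Zmod_def)

lemma mult_Zmod [simp]: "x \<otimes>\<^bsub>Zmod m\<^esub> y = (x + y) mod \<bar>m\<bar>"
  by (simp add: Zmod_def)

text \<open>
  Only the source is assumed to be a group: the target inherits the group laws through the surjection. For
  homology, a quotient of a subgroup of a quotient, this saves checking them directly.
\<close>

lemma Mod_kernel_iso_of_surj:
  assumes G: "group G" and h: "h \<in> hom G H" and one: "h \<one>\<^bsub>G\<^esub> = \<one>\<^bsub>H\<^esub>"
    and surj: "h ` carrier G = carrier H"
  shows "group H" "G Mod kernel G H h \<cong> H"
proof -
  have "group (H\<lparr>carrier := h ` carrier G, one := h \<one>\<^bsub>G\<^esub>\<rparr>)"
    using group.hom_imp_img_group[OF G h] .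
  then show H: "group H"
    by (simp add: one surj)
  interpret group_hom G H h
    by (simp add: G H h group_hom.intro group_hom_axioms.intro)
  show "G Mod kernel G H h \<cong> H"
    using FactGroup_iso surj by blast
qed

context torsion_free_int_module
begin

lemma group_additive_group: "subspace S \<Longrightarrow> group (additive_group S)"
  by (rule groupI) (auto simp: subspace_add subspace_0 add.assoc intro: bexI[of _ "- _"] subspace_neg)

lemma representation_lincomb:
  assumes "finite B" "independent B" "b \<in> B"
  shows "representation B (\<Sum>v\<in>B. c v *s v) b = c b"
proof -
  have "representation B (\<Sum>v\<in>B. c v *s v) = (\<lambda>b. \<Sum>v\<in>B. representation B (c v *s v) b)"
    using assms by (intro representation_sum) (auto intro: span_scale span_base)
  also have "\<dots> = (\<lambda>b. \<Sum>v\<in>B. c v * (if b = v then 1 else 0))"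
    using assms by (intro ext sum.cong) (auto simp: representation_scale representation_basis span_base)
  finally show ?thesis
    using assms by (simp add: if_distrib cong: if_cong)
qed

lemma mem_span_scaled_basis:
  assumes B: "basis_of S B"
  shows "z \<in> span ((\<lambda>b. m b *s b) ` B) \<longleftrightarrow> z \<in> S \<and> (\<forall>b\<in>B. m b dvd representation B z b)"
proof -
  have fin: "finite B" and ind: "independent B" and sp: "span B = S"
    using B by (auto simp: basis_of_def)
  let ?P = "\<lambda>z. z \<in> S \<and> (\<forall>b\<in>B. m b dvd representation B z b)"
  show ?thesis
  proof
    assume "z \<in> span ((\<lambda>b. m b *s b) ` B)"
    then show "?P z"
    proof (rule span_induct)
      show "subspace {z. ?P z}"
      proof (rule subspaceI)
        show "0 \<in> {z. ?P z}"
          using sp by (auto simp: representation_zero span_zero)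
        show "x + y \<in> {z. ?P z}" if "x \<in> {z. ?P z}" "y \<in> {z. ?P z}" for x y
          using that sp by (auto simp: representation_add[OF ind] span_add)
        show "c *s x \<in> {z. ?P z}" if "x \<in> {z. ?P z}" for x c
          using that sp by (auto simp: representation_scale[OF ind] span_scale)
      qed
      show "?P x" if "x \<in> (\<lambda>b. m b *s b) ` B" for x
        using that sp span_base[of _ B]
        by (auto simp: representation_scale[OF ind] representation_basis[OF ind] span_scale)
    qed
  next
    assume z: "?P z"
    have "z = (\<Sum>b\<in>B. representation B z b *s b)"
      using z sum_representation_eq[OF ind _ fin] sp by simp
    also have "\<dots> \<in> span ((\<lambda>b. m b *s b) ` B)"
    proof (rule span_sum)
      fix b assume b: "b \<in> B"
      then obtain k where "representation B z b = m b * k"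
        using z by (auto elim: dvdE)
      then have "representation B z b *s b = k *s (m b *s b)"
        by (simp add: mult.commute)
      then show "representation B z b *s b \<in> span ((\<lambda>b. m b *s b) ` B)"
        using b by (simp only:) (intro span_scale span_base imageI)
    qed
    finally show "z \<in> span ((\<lambda>b. m b *s b) ` B)" .
  qed
qed

text \<open>
  The last step of every homology computation: reduce the coordinates in an adapted basis of the cycles
  modulo the respective multiplier.
\<close>

lemma quotient_by_scaled_basis:
  assumes B: "basis_of Z (P \<union> Q)" and disj: "P \<inter> Q = {}"
  shows "additive_group Z Mod span ((*s) m ` P \<union> (*s) k ` Q)
      \<cong> group_power (Zmod m) (card P) \<times>\<times> group_power (Zmod k) (card Q)"
proof -
  let ?B = "P \<union> Q"
  have fin: "finite P" "finite Q" and ind: "independent ?B" and sp: "span ?B = Z"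
    using B by (auto simp: basis_of_def)
  obtain p where p: "bij_betw p {..<card P} P"
    using ex_bij_betw_nat_finite[OF fin(1)] atLeast0LessThan by auto
  obtain q where q: "bij_betw q {..<card Q} Q"
    using ex_bij_betw_nat_finite[OF fin(2)] atLeast0LessThan by auto
  let ?r = "representation ?B"
  define coords where "coords f M l z = (\<lambda>i\<in>{..<l}. ?r z (f i) mod \<bar>M\<bar>)"
    for f :: "nat \<Rightarrow> 'b" and M :: int and l :: nat and z
  let ?h = "\<lambda>z. (coords p m (card P) z, coords q k (card Q) z)"
  let ?G = "additive_group Z"
  let ?H = "group_power (Zmod m) (card P) \<times>\<times> group_power (Zmod k) (card Q)"
  have G: "group ?G"
    using group_additive_group subspace_basis_of[OF B] by blast
  have coords_closed: "coords f M l z \<in> carrier (group_power (Zmod M) l)" for f M l z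
    by (auto simp: coords_def group_power_def carrier_Zmod)
  have coords_add: "coords f M l (x + y) = coords f M l x \<otimes>\<^bsub>group_power (Zmod M) l\<^esub> coords f M l y"
    if "x \<in> Z" "y \<in> Z" for f M l x y
    using that sp ind by (auto simp: coords_def group_power_def representation_add mod_add_eq)
  have hom: "?h \<in> hom ?G ?H"
    by (rule homI) (auto simp: coords_closed coords_add)
  have coords_one: "coords f M l z = \<one>\<^bsub>group_power (Zmod M) l\<^esub> \<longleftrightarrow> (\<forall>i<l. M dvd ?r z (f i))"
    for f M l z
    by (auto simp: coords_def group_power_def fun_eq_iff restrict_def mod_eq_0_iff_dvd)
  have one: "?h \<one>\<^bsub>?G\<^esub> = \<one>\<^bsub>?H\<^esub>"
    using coords_one by (simp add: representation_zero)
  have surj: "?h ` carrier ?G = carrier ?H"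
  proof
    show "?h ` carrier ?G \<subseteq> carrier ?H"
      using hom hom_carrier by blast
    show "carrier ?H \<subseteq> ?h ` carrier ?G"
    proof
      fix v assume "v \<in> carrier ?H"
      then obtain v1 v2 where v: "v = (v1, v2)" "v1 \<in> carrier (group_power (Zmod m) (card P))"
          "v2 \<in> carrier (group_power (Zmod k) (card Q))"
        by (auto simp: DirProd_def)
      define c where "c b = (if b \<in> P then v1 (the_inv_into {..<card P} p b)
          else v2 (the_inv_into {..<card Q} q b))" for b
      define z where "z = (\<Sum>b\<in>?B. c b *s b)"
      have r: "?r z b = c b" if "b \<in> ?B" for b
        unfolding z_def using fin ind that by (intro representation_lincomb) auto
      have cp: "c (p i) = v1 i" if "i < card P" for i
        using that p by (auto simp: c_def bij_betw_def the_inv_into_f_f)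
      have cq: "c (q i) = v2 i" if "i < card Q" for i
        using that q disj by (auto simp: c_def bij_betw_def the_inv_into_f_f)
      have rp: "?r z (p i) = v1 i" if "i < card P" for i
        using cp[OF that] r bij_betwE[OF p] that by auto
      have rq: "?r z (q i) = v2 i" if "i < card Q" for i
        using cq[OF that] r bij_betwE[OF q] that by auto
      have "coords p m (card P) z = v1"
        using v(2) rp unfolding coords_def group_power_def
        by (intro ext) (auto simp: carrier_Zmod PiE_iff extensional_def)
      moreover have "coords q k (card Q) z = v2"
        using v(3) rq unfolding coords_def group_power_def
        by (intro ext) (auto simp: carrier_Zmod PiE_iff extensional_def)
      moreover have "z \<in> Z"
        unfolding z_def sp[symmetric] by (intro span_sum span_scale span_base)
      ultimately show "v \<in> ?h ` carrier ?G"
        using v(1) by force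
    qed
  qed
  \<comment> \<open>The multiplier of each basis element, so that the membership criterion applies to both parts at once.\<close>
  define w where "w b = (if b \<in> P then m else k)" for b
  have "(*s) m ` P \<union> (*s) k ` Q = (\<lambda>b. w b *s b) ` ?B"
  proof -
    have "(\<lambda>b. w b *s b) ` P = (*s) m ` P" "(\<lambda>b. w b *s b) ` Q = (*s) k ` Q"
      using disj by (auto simp: w_def intro!: image_cong)
    then show ?thesis by (simp add: image_Un)
  qed
  moreover have "kernel ?G ?H ?h = {z \<in> Z. \<forall>b\<in>?B. w b dvd ?r z b}"
  proof -
    have "(\<forall>i<card P. m dvd ?r z (p i)) \<longleftrightarrow> (\<forall>b\<in>P. w b dvd ?r z b)" for z
    proof -
      have "(\<forall>b\<in>P. w b dvd ?r z b) \<longleftrightarrow> (\<forall>b\<in>p ` {..<card P}. m dvd ?r z b)"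
        using bij_betw_imp_surj_on[OF p] by (simp add: w_def)
      then show ?thesis by auto
    qed
    moreover have "(\<forall>i<card Q. k dvd ?r z (q i)) \<longleftrightarrow> (\<forall>b\<in>Q. w b dvd ?r z b)" for z
    proof -
      have "w b = k" if "b \<in> Q" for b using that disj by (auto simp: w_def)
      then have "(\<forall>b\<in>Q. w b dvd ?r z b) \<longleftrightarrow> (\<forall>b\<in>q ` {..<card Q}. k dvd ?r z b)"
        using bij_betw_imp_surj_on[OF q] by simp
      then show ?thesis by auto
    qed
    ultimately show ?thesis
      by (auto simp: kernel_def coords_one)
  qed
  ultimately have "span ((*s) m ` P \<union> (*s) k ` Q) = kernel ?G ?H ?h"
    using mem_span_scaled_basis[OF B, of _ w] by auto
  then show ?thesis
    using Mod_kernel_iso_of_surj(2)[OF G hom one surj] by simp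
qed

end

section \<open>Complexes whose differential has a retract as image\<close>

text \<open>
  The axioms describe \<open>D = \<partial>\<^sub>R\<close> on reduced chains of tuples of length \<open>l\<close>: \<open>q\<close> doubles the first entry and \<open>e\<close>
  drops it. The index is the length, one more than the degree, so that \<open>C 0\<close> stands for the vanishing
  chains in degree \<open>-1\<close>.
\<close>

locale retracted_complex = torsion_free_int_module scale
  for scale :: "int \<Rightarrow> 'b::ab_group_add \<Rightarrow> 'b" (infixr \<open>*s\<close> 75) +
  fixes C :: "nat \<Rightarrow> 'b set" and D q e :: "'b \<Rightarrow> 'b"
  assumes C_free: "\<exists>A. basis_of (C l) A"
    and C_0: "C 0 = {0}"
    and linear_D: "linear_map D" and linear_q: "linear_map q" and linear_e: "linear_map e"
    and D_closed: "x \<in> C (Suc l) \<Longrightarrow> D x \<in> C l"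
    and q_closed: "x \<in> C l \<Longrightarrow> q x \<in> C (Suc l)"
    and e_closed: "x \<in> C (Suc l) \<Longrightarrow> e x \<in> C l"
    and D_D: "x \<in> C l \<Longrightarrow> D (D x) = 0"
    and q_homotopy: "x \<in> C (Suc l) \<Longrightarrow> q (D x) + D (q x) = q (e x)"
    and e_q: "x \<in> C l \<Longrightarrow> e (q x) = x"
    and q_e_D: "x \<in> C l \<Longrightarrow> q (e (D x)) = D x"
begin

sublocale D: module_hom scale scale D by (rule linear_D)
sublocale q: module_hom scale scale q by (rule linear_q)
sublocale e: module_hom scale scale e by (rule linear_e)

lemma subspace_C: "subspace (C l)"
  using C_free subspace_basis_of by blast

lemma subspace_free: "subspace S \<Longrightarrow> S \<subseteq> C l \<Longrightarrow> \<exists>A. basis_of S A"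
  using C_free subspace_of_has_basis by blast

lemma D_pred: "x \<in> C l \<Longrightarrow> D x \<in> C (l - 1)"
  by (cases l) (auto simp: C_0 D_closed)

text \<open>
  By \<open>q_homotopy\<close> on the cycle \<open>D x\<close>, where \<open>q e\<close> acts as the identity. Consequently \<open>D q\<close> is a retraction onto the
  image of \<open>D\<close>.
\<close>

lemma D_q_D:
  assumes "x \<in> C l"
  shows "D (q (D x)) = D x"
proof -
  have "D x = 0" if "l - 1 = 0"
    using D_pred[OF assms] that C_0 by simp
  moreover have ?thesis if "l - 1 = Suc m" for m
  proof -
    have "q (D (D x)) + D (q (D x)) = q (e (D x))"
      using D_pred[OF assms] that by (intro q_homotopy[of _ m]) simp
    then show ?thesis
      using D_D[OF assms] q_e_D[OF assms] by simp
  qed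
  ultimately show ?thesis
    by (cases "l - 1") auto
qed

lemma D_q_e:
  assumes x: "x \<in> C (Suc l)"
  shows "D (q (e x)) = D x"
proof -
  have "D (q (e x)) = D (q (D x)) + D (D (q x))"
    using q_homotopy[OF x, symmetric] by (simp add: D.add)
  then show ?thesis
    using D_q_D[OF x] D_D[OF q_closed[OF x]] by simp
qed

lemma kernel_D_in_q_image:
  "{x \<in> q ` C l. D x = 0} = D ` C (Suc (Suc l))"
proof safe
  fix x assume x: "x \<in> C l" "D (q x) = 0"
  have "q (D (q x)) + D (q (q x)) = q (e (q x))"
    using q_closed[OF x(1)] by (rule q_homotopy)
  then have "q x = D (q (q x))"
    using x e_q by simp
  then show "q x \<in> D ` C (Suc (Suc l))"
    using x(1) q_closed by blast
next
  fix x assume x: "x \<in> C (Suc (Suc l))"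
  have "D x = q (e (D x))" using q_e_D[OF x] by simp
  then show "D x \<in> q ` C l"
    using x D_closed e_closed by blast
  show "D (D x) = 0" using x by (rule D_D)
qed

text \<open>
  Both images are read off from the copy \<open>q C\<^sub>l\<close> of \<open>C\<^sub>l\<close> inside \<open>C\<^sub>l\<^sub>+\<^sub>1\<close>: every boundary lies in such a copy, on it every
  cycle is a boundary, and \<open>D\<close> maps it onto all of \<open>D C\<^sub>l\<^sub>+\<^sub>1\<close>. So this is rank-nullity for \<open>D\<close> on \<open>q C\<^sub>l\<close>.
\<close>

lemma rank_D_image_add:
  "rank (D ` C (Suc (Suc l))) + rank (D ` C (Suc l)) = rank (C l)"
proof -
  obtain A where A: "basis_of (C l) A" using C_free by blast
  obtain A' where A': "basis_of (C (Suc l)) A'" using C_free by blast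
  have sub: "q ` C l \<subseteq> C (Suc l)" using q_closed by blast
  have "rank (q ` C l) = rank (C l)"
  proof (rule rank_inj_image[OF linear_q A A' sub])
    show "x = 0" if "x \<in> C l" "q x = 0" for x
      using that e_q[of x l] by simp
  qed
  moreover obtain Q where Q: "basis_of (q ` C l) Q"
    using subspace_free[OF q.subspace_image[OF subspace_C] sub] by blast
  have img: "D ` q ` C l = D ` C (Suc l)"
  proof safe
    fix x assume "x \<in> C l"
    then show "D (q x) \<in> D ` C (Suc l)" using q_closed by blast
  next
    fix x assume x: "x \<in> C (Suc l)"
    then show "D x \<in> D ` q ` C l"
      using D_q_e[OF x] e_closed[OF x] by (metis imageI)
  qed
  moreover have "rank (q ` C l) = rank {x \<in> q ` C l. D x = 0} + rank (D ` q ` C l)"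
    by (rule rank_nullity[OF linear_D Q A]) (use D_closed img in auto)
  ultimately show ?thesis
    by (simp add: kernel_D_in_q_image)
qed

lemma kernel_D_basis:
  obtains P Q where "basis_of {x \<in> C l. D x = 0} (P \<union> Q)" "P \<inter> Q = {}"
    "basis_of (D ` C (Suc l)) Q" "card P + card Q + rank (D ` C l) = rank (C l)"
proof -
  let ?Z = "{x \<in> C l. D x = 0}"
  obtain A where A: "basis_of (C l) A" using C_free by blast
  obtain Z where Z: "basis_of ?Z Z"
    using subspace_free[OF subspace_kernel_in[OF linear_D subspace_C]] by blast
  have sub: "D ` C (Suc l) \<subseteq> ?Z" using D_closed D_D by blast
  obtain Q where Q: "basis_of (D ` C (Suc l)) Q"
    using subspace_free[OF D.subspace_image[OF subspace_C], of "Suc l" l] sub by blast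
  have "linear_map (D \<circ> q)"
    using linear_D linear_q module_hom_compose by blast
  then obtain P where P: "basis_of ?Z (P \<union> Q)" "P \<inter> Q = {}"
    by (rule retract_basis_extends[OF _ Z Q sub]) (auto simp: q_closed D_q_D)
  have "rank (C l) = card (P \<union> Q) + rank (D ` C l)"
    using rank_nullity[OF linear_D A, of "C (l - 1)"] C_free[of "l - 1"] D_pred rank_eq_card[OF P(1)]
    by auto
  then show ?thesis
    using that[OF P Q] P by (simp add: basis_of_def card_Un_disjoint)
qed

end

section \<open>Adding a contracted anticommuting differential\<close>

text \<open>
  A second differential \<open>\<delta>\<close> that anticommutes with \<open>D\<close> and has a contraction \<open>s\<close> anticommuting with \<open>D\<close>. Then
  \<open>\<delta> s\<close> and \<open>s \<delta>\<close> are complementary idempotents, so \<open>C = K \<oplus> s K\<close> for \<open>K = ker \<delta> = im \<delta> s\<close>.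
\<close>

locale contracted_complex = retracted_complex scale C D q e
  for scale :: "int \<Rightarrow> 'b::ab_group_add \<Rightarrow> 'b" (infixr \<open>*s\<close> 75)
    and C D q e +
  fixes \<delta> s :: "'b \<Rightarrow> 'b"
  assumes linear_\<delta>: "linear_map \<delta>" and linear_s: "linear_map s"
    and \<delta>_closed: "x \<in> C (Suc l) \<Longrightarrow> \<delta> x \<in> C l"
    and s_closed: "x \<in> C l \<Longrightarrow> s x \<in> C (Suc l)"
    and \<delta>_\<delta>: "x \<in> C l \<Longrightarrow> \<delta> (\<delta> x) = 0"
    and \<delta>_D: "x \<in> C l \<Longrightarrow> \<delta> (D x) = - D (\<delta> x)"
    and \<delta>_s: "x \<in> C l \<Longrightarrow> \<delta> (s x) = x - s (\<delta> x)"
    and D_s: "x \<in> C l \<Longrightarrow> D (s x) = - s (D x)"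
begin

sublocale \<delta>: module_hom scale scale \<delta> by (rule linear_\<delta>)
sublocale s: module_hom scale scale s by (rule linear_s)

definition K :: "nat \<Rightarrow> 'b set" where
  "K l = {x \<in> C l. \<delta> x = 0}"

lemma \<delta>_pred: "x \<in> C l \<Longrightarrow> \<delta> x \<in> C (l - 1)"
  by (cases l) (auto simp: C_0 \<delta>_closed)

lemma subspace_K: "subspace (K l)"
  unfolding K_def by (rule subspace_kernel_in[OF linear_\<delta> subspace_C])

lemma K_C: "x \<in> K l \<Longrightarrow> x \<in> C l"
  by (simp add: K_def)

lemma K_0: "K 0 = {0}"
  by (auto simp: K_def C_0)

lemma \<delta>_s_K: "x \<in> K l \<Longrightarrow> \<delta> (s x) = x"
  using \<delta>_s[of x l] by (auto simp: K_def s.zero)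

lemma \<delta>_image: "\<delta> ` C (Suc l) = K l"
proof safe
  show "\<delta> x \<in> K l" if "x \<in> C (Suc l)" for x
    using that by (simp add: K_def \<delta>_closed \<delta>_\<delta>)
  show "x \<in> \<delta> ` C (Suc l)" if "x \<in> K l" for x
    using that \<delta>_s_K s_closed K_C by (metis imageI)
qed

lemma \<delta>_s_closed: "x \<in> C l \<Longrightarrow> \<delta> (s x) \<in> K l"
  using \<delta>_image s_closed by blast

lemma D_K: "x \<in> K (Suc l) \<Longrightarrow> D x \<in> K l"
  using \<delta>_D[of x "Suc l"] by (auto simp: K_def D_closed D.zero)

lemma D_\<delta>_s: "x \<in> C l \<Longrightarrow> D (\<delta> (s x)) = \<delta> (s (D x))"
  using \<delta>_D[OF s_closed, of x l] by (simp add: D_s \<delta>.neg)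

text \<open>
  Projecting \<open>q\<close> to \<open>K\<close> by \<open>\<delta> s\<close>, which commutes with \<open>D\<close>, turns the retraction \<open>D q\<close> into one inside \<open>K\<close>.
\<close>

lemma D_retract_D:
  assumes x: "x \<in> K (Suc l)"
  shows "D (\<delta> (s (q (D x)))) = D x"
proof -
  have "D (\<delta> (s (q (D x)))) = \<delta> (s (D (q (D x))))"
    by (rule D_\<delta>_s) (use x K_C D_closed q_closed in blast)
  also have "\<dots> = D (\<delta> (s x))"
    using D_q_D[OF K_C[OF x]] D_\<delta>_s[OF K_C[OF x]] by simp
  finally show ?thesis
    using x \<delta>_s_K by simp
qed

lemma rank_K_add: "rank (K (Suc l)) + rank (K l) = rank (C (Suc l))"
proof -
  obtain A where A: "basis_of (C (Suc l)) A" using C_free by blast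
  obtain A' where A': "basis_of (C l) A'" using C_free by blast
  have "rank (C (Suc l)) = rank (K (Suc l)) + rank (\<delta> ` C (Suc l))"
    unfolding K_def by (rule rank_nullity[OF linear_\<delta> A A']) (use \<delta>_closed in blast)
  then show ?thesis
    by (simp add: \<delta>_image)
qed

text \<open>
  Rank-nullity for \<open>\<delta>\<close> on the group of \<open>D\<close>-boundaries.
\<close>

lemma rank_D_K_add: "rank (D ` K (Suc l)) + rank (D ` K l) = rank (D ` C (Suc l))"
proof -
  let ?S = "D ` C (Suc l)"
  have sub: "?S \<subseteq> C l" using D_closed by blast
  obtain A where A: "basis_of ?S A"
    using subspace_free[OF D.subspace_image[OF subspace_C] sub] by blast
  obtain A' where A': "basis_of (C (l - 1)) A'" using C_free by blast
  have ker: "{y \<in> ?S. \<delta> y = 0} = D ` K (Suc l)"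
  proof safe
    fix x assume x: "x \<in> C (Suc l)" "\<delta> (D x) = 0"
    have "D x = \<delta> (s (D x))"
      using \<delta>_s[OF D_closed[OF x(1)]] x(2) by simp
    also have "\<dots> = D (\<delta> (s x))"
      using D_\<delta>_s[OF x(1)] by simp
    finally show "D x \<in> D ` K (Suc l)"
      using \<delta>_s_closed[OF x(1)] by blast
  next
    fix x assume x: "x \<in> K (Suc l)"
    then show "D x \<in> D ` C (Suc l)" using K_C by blast
    show "\<delta> (D x) = 0" using D_K[OF x] by (simp add: K_def)
  qed
  have im: "\<delta> ` ?S = D ` K l"
  proof safe
    fix x assume x: "x \<in> C (Suc l)"
    have "\<delta> (D x) = D (\<delta> (- x))" using x by (simp add: \<delta>_D \<delta>.neg D.neg)
    then show "\<delta> (D x) \<in> D ` K l"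
      using \<delta>_image x subspace_neg[OF subspace_C] by blast
  next
    fix x assume "x \<in> K l"
    then have "x \<in> \<delta> ` C (Suc l)" by (simp add: \<delta>_image)
    then obtain y where y: "y \<in> C (Suc l)" "x = \<delta> y" by blast
    then have "D x = \<delta> (D (- y))" by (simp add: \<delta>_D \<delta>.neg D.neg)
    then show "D x \<in> \<delta> ` D ` C (Suc l)"
      using y(1) subspace_neg[OF subspace_C] by blast
  qed
  have "rank ?S = rank {y \<in> ?S. \<delta> y = 0} + rank (\<delta> ` ?S)"
    by (rule rank_nullity[OF linear_\<delta> A A']) (use sub \<delta>_pred in blast)
  then show ?thesis
    by (simp only: ker im)
qed

lemma K_D_basis:
  obtains W T U where "basis_of {x \<in> K l. D x = 0} (W \<union> T)" "W \<inter> T = {}"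
    "basis_of (D ` K (Suc l)) T" "basis_of (K l) (W \<union> T \<union> U)" "(W \<union> T) \<inter> U = {}"
    "U \<subseteq> K l" "inj_on D U" "basis_of (D ` K l) (D ` U)"
proof -
  let ?Z = "{x \<in> K l. D x = 0}"
  have KC: "K l \<subseteq> C l" using K_C by blast
  obtain A where A: "basis_of (K l) A" using subspace_free[OF subspace_K KC] by blast
  obtain Z where Z: "basis_of ?Z Z"
    using subspace_free[OF subspace_kernel_in[OF linear_D subspace_K]] KC by blast
  have sub: "D ` K (Suc l) \<subseteq> ?Z" using D_K D_D K_C by blast
  obtain T where T: "basis_of (D ` K (Suc l)) T"
    using subspace_free[OF D.subspace_image[OF subspace_K], of "Suc l" l] sub KC by blast
  have h: "linear_map (D \<circ> \<delta> \<circ> s \<circ> q)"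
    using linear_D linear_\<delta> linear_s linear_q module_hom_compose by blast
  obtain W where W: "basis_of ?Z (W \<union> T)" "W \<inter> T = {}"
  proof (rule retract_basis_extends[OF h Z T sub])
    show "(D \<circ> \<delta> \<circ> s \<circ> q) x \<in> D ` K (Suc l)" if "x \<in> ?Z" for x
      using that by (simp add: K_C q_closed \<delta>_s_closed)
    show "(D \<circ> \<delta> \<circ> s \<circ> q) y = y" if "y \<in> D ` K (Suc l)" for y
      using that D_retract_D by auto
  qed (rule that)
  have "D ` K l \<subseteq> C (l - 1)" using D_pred K_C by blast
  then obtain V where V: "basis_of (D ` K l) V"
    using subspace_free[OF D.subspace_image[OF subspace_K]] by blast
  from basis_of_subset[OF V] obtain U where U: "U \<subseteq> K l" "inj_on D U" "D ` U = V"
    by (rule image_basis_lift)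
  show ?thesis
    using that[OF W T] basis_of_kernel_Un_lift[OF linear_D subspace_K W(1) V U] U V by blast
qed

end

text \<open>
  The homology of the differential \<open>g \<delta> + d D\<close>, called \<open>total\<close> here. In the decomposition \<open>x = k + s y\<close> with
  \<open>k\<close>, \<open>y\<close> in \<open>K\<close> it is the mapping cone of \<open>g\<close> on \<open>(K, d D)\<close>.
\<close>

locale weighted_complex = contracted_complex scale C D q e \<delta> s
  for scale :: "int \<Rightarrow> 'b::ab_group_add \<Rightarrow> 'b" (infixr \<open>*s\<close> 75)
    and C D q e \<delta> s +
  fixes g d :: int
begin

definition total :: "'b \<Rightarrow> 'b" where
  "total x = g *s \<delta> x + d *s D x"

definition G :: int where "G = gcd g d"

text \<open>
  For \<open>x\<close> in \<open>K\<close> the boundary of \<open>s x\<close> is \<open>g x - d s D x\<close>. This is divisible by \<open>G\<close>, and the quotient \<open>lift x\<close> is a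
  cycle even if \<open>x\<close> is none. The lifts of \<open>U\<close> complete the cycles of \<open>D\<close> in \<open>K\<close> to all cycles.
\<close>

definition lift :: "'b \<Rightarrow> 'b" where
  "lift x = (g div G) *s x - (d div G) *s s (D x)"

lemma linear_total: "linear_map total"
  unfolding total_def
  by unfold_locales (simp_all add: \<delta>.add D.add \<delta>.scale D.scale algebra_simps)

lemma linear_lift: "linear_map lift"
  unfolding lift_def
  by unfold_locales (simp_all add: s.add D.add s.scale D.scale algebra_simps)

sublocale total: module_hom scale scale total by (rule linear_total)
sublocale lift: module_hom scale scale lift by (rule linear_lift)

lemma G_mult: "g = G * (g div G)" "d = G * (d div G)"
  by (simp_all add: G_def)

lemma scale_G_lift: "G *s lift x = g *s x - d *s s (D x)"
  by (simp add: lift_def scale_right_diff_distrib flip: G_mult)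

lemma total_s:
  assumes "x \<in> K l"
  shows "total (s x) = G *s lift x"
  using assms by (simp add: total_def \<delta>_s_K D_s[OF K_C] scale_G_lift)

lemma D_lift:
  assumes x: "x \<in> K (Suc l)"
  shows "D (lift x) = (g div G) *s D x"
  using x D_s[OF K_C[OF D_K[OF x]]] D_D[OF K_C[OF x]]
  by (simp add: lift_def D.diff D.scale s.zero)

lemma \<delta>_lift:
  assumes x: "x \<in> K (Suc l)"
  shows "\<delta> (lift x) = - ((d div G) *s D x)"
  using x \<delta>_s_K[OF D_K[OF x]] by (simp add: lift_def \<delta>.diff \<delta>.scale K_def)

lemma \<delta>_s_lift:
  assumes x: "x \<in> K (Suc l)"
  shows "\<delta> (s (lift x)) = (g div G) *s x"
proof -
  have "\<delta> (s (s (D x))) = 0"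
    using x \<delta>_s[OF s_closed[OF K_C[OF D_K[OF x]]]] by (simp add: \<delta>_s_K[OF D_K])
  then show ?thesis
    using \<delta>_s_K[OF x] by (simp add: lift_def s.diff s.scale \<delta>.diff \<delta>.scale)
qed

lemma lift_closed:
  assumes x: "x \<in> K (Suc l)"
  shows "lift x \<in> C (Suc l)"
  unfolding lift_def
  by (intro subspace_diff subspace_scale subspace_C s_closed) (use x D_K K_C in blast)+

lemma total_lift:
  assumes x: "x \<in> K (Suc l)"
  shows "total (lift x) = 0"
proof -
  have "g * (d div G) = d * (g div G)"
    by (metis G_mult mult.assoc mult.commute)
  then show ?thesis
    using x by (simp add: total_def D_lift \<delta>_lift)
qed

lemma total_decompose:
  assumes x: "x \<in> C l"
  shows "total x = d *s D (\<delta> (s x)) + G *s lift (\<delta> x)"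
proof -
  have "D x = D (\<delta> (s x) + s (\<delta> x))"
    using \<delta>_s[OF x] by simp
  also have "\<dots> = D (\<delta> (s x)) - s (D (\<delta> x))"
    using D_s[OF \<delta>_pred[OF x]] by (simp add: D.add)
  finally show ?thesis
    by (simp add: total_def scale_G_lift scale_right_diff_distrib)
qed

text \<open>
  The equation that makes \<open>k + s y\<close> a cycle, after division by \<open>G\<close>.
\<close>

lemma total_cycle:
  assumes g: "g \<noteq> 0" and x: "x \<in> C l" and cyc: "total x = 0"
  shows "(g div G) *s \<delta> x = - ((d div G) *s D (\<delta> (s x)))"
proof -
  have "0 = \<delta> (total x)" using cyc \<delta>.zero by simp
  also have "\<dots> = - (d *s D (\<delta> x))"
    using x by (simp add: total_def \<delta>.add \<delta>.scale \<delta>_\<delta> \<delta>_D)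
  finally have "d *s s (D (\<delta> x)) = 0"
    by (metis neg_equal_0_iff_equal s.scale s.zero)
  then have "0 = G *s ((d div G) *s D (\<delta> (s x)) + (g div G) *s \<delta> x)"
    using total_decompose[OF x] cyc
    by (simp add: scale_G_lift scale_right_distrib flip: G_mult)
  moreover have "G \<noteq> 0" using g by (simp add: G_def)
  ultimately have "(d div G) *s D (\<delta> (s x)) + (g div G) *s \<delta> x = 0"
    using scale_eq_0D by metis
  then show ?thesis
    by (simp add: eq_neg_iff_add_eq_0 add.commute)
qed

lemma G_bezout:
  assumes "g \<noteq> 0"
  obtains \<gamma> \<eta> where "\<gamma> * g + \<eta> * d = G" "\<gamma> * (g div G) + \<eta> * (d div G) = 1"
proof -
  obtain \<gamma> \<eta> where *: "\<gamma> * g + \<eta> * d = G"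
    using bezout_int[of g d] by (auto simp: G_def)
  have "G \<noteq> 0" using assms by (simp add: G_def)
  moreover have "G * (\<gamma> * (g div G) + \<eta> * (d div G)) = \<gamma> * (G * (g div G)) + \<eta> * (G * (d div G))"
    by (simp add: algebra_simps)
  then have "G * (\<gamma> * (g div G) + \<eta> * (d div G)) = G * 1"
    using * G_mult by simp
  ultimately show ?thesis
    using that[OF *] by simp
qed

lemma g_div_G: "g \<noteq> 0 \<Longrightarrow> g div G \<noteq> 0"
  using G_mult(1) by fastforce

lemma cycle_kernel:
  assumes g: "g \<noteq> 0"
  shows "{x \<in> {x \<in> C l. total x = 0}. D (\<delta> (s x)) = 0} = {x \<in> K l. D x = 0}"
proof safe
  fix x assume x: "x \<in> C l" "total x = 0" "D (\<delta> (s x)) = 0"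
  then have "\<delta> x = 0"
    using total_cycle[OF g x(1,2)] scale_eq_0D[OF _ g_div_G[OF g]] by simp
  then show "x \<in> K l" using x(1) by (simp add: K_def)
  then show "D x = 0" using x(3) \<delta>_s_K by simp
next
  fix x assume x: "x \<in> K l" "D x = 0"
  then show "x \<in> C l" "total x = 0" "D (\<delta> (s x)) = 0"
    by (simp_all add: K_C \<delta>_s_K) (simp add: total_def K_def)
qed

text \<open>
  The \<open>K\<close>-component \<open>k\<close> of a cycle has \<open>D k\<close> divisible by \<open>g / G\<close> in \<open>K\<close>, since \<open>g / G\<close> and \<open>d / G\<close> are coprime. The
  image of \<open>D\<close> is a direct summand of \<open>K\<close>, so \<open>D k\<close> is divisible within the image as well.
\<close>

lemma cycle_image:
  assumes g: "g \<noteq> 0"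
  shows "(\<lambda>x. D (\<delta> (s x))) ` {x \<in> C (Suc l). total x = 0} = (*s) (g div G) ` D ` K (Suc l)"
proof safe
  fix x assume x: "x \<in> C (Suc l)" "total x = 0"
  let ?k = "\<delta> (s x)"
  obtain \<gamma> \<eta> where b: "\<gamma> * (g div G) + \<eta> * (d div G) = 1"
    using G_bezout[OF g] by blast
  \<comment> \<open>A Bezout combination: \<open>(g / G) \<delta> x = - (d / G) D k\<close> gives \<open>(g / G) w = D k\<close>.\<close>
  define w where "w = \<gamma> *s D ?k - \<eta> *s \<delta> x"
  have k: "?k \<in> K (Suc l)" using x(1) \<delta>_s_closed by blast
  have "(g div G) *s w = \<gamma> *s ((g div G) *s D ?k) - \<eta> *s ((g div G) *s \<delta> x)"
    by (simp add: w_def scale_right_diff_distrib mult.commute)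
  also have "\<dots> = \<gamma> *s ((g div G) *s D ?k) + \<eta> *s ((d div G) *s D ?k)"
    using total_cycle[OF g x] by simp
  also have "\<dots> = (\<gamma> * (g div G) + \<eta> * (d div G)) *s D ?k"
    by (simp add: scale_left_distrib)
  finally have gw: "(g div G) *s w = D ?k" using b by simp
  have "w \<in> C l"
    unfolding w_def
    by (intro subspace_diff subspace_scale subspace_C) (use k D_K K_C \<delta>_closed x(1) in blast)+
  then have "\<delta> (s (q w)) \<in> K (Suc l)"
    using q_closed \<delta>_s_closed by blast
  \<comment> \<open>Replacing \<open>w\<close> by its retraction \<open>D \<delta> s q w\<close> puts the quotient into the image of \<open>D\<close>.\<close>
  moreover have "D (\<delta> (s (q (D ?k)))) = (g div G) *s D (\<delta> (s (q w)))"
    unfolding gw[symmetric] by (simp add: D.scale \<delta>.scale s.scale q.scale)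
  then have "D ?k = (g div G) *s D (\<delta> (s (q w)))"
    using D_retract_D[OF k] by simp
  ultimately show "D ?k \<in> (*s) (g div G) ` D ` K (Suc l)" by blast
next
  fix x assume x: "x \<in> K (Suc l)"
  have "D (\<delta> (s (lift x))) = (g div G) *s D x"
    using x by (simp add: \<delta>_s_lift D.scale)
  then show "(g div G) *s D x \<in> (\<lambda>x. D (\<delta> (s x))) ` {x \<in> C (Suc l). total x = 0}"
    using lift_closed[OF x] total_lift[OF x] by (intro image_eqI[of _ _ "lift x"]) simp_all
qed

text \<open>
  The cycles have the basis \<open>W \<union> T \<union> lift U\<close>. A boundary is \<open>d D k + G lift y\<close>, and \<open>lift\<close> multiplies \<open>W\<close> and \<open>T\<close> by
  \<open>g / G\<close>; so \<open>W\<close> contributes multiples of \<open>g\<close> only, \<open>T\<close> multiples of \<open>g\<close> and \<open>d\<close>, that is of \<open>G\<close>, and \<open>lift U\<close>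
  multiples of \<open>G\<close>.
\<close>

theorem total_cycles_basis:
  assumes g: "g \<noteq> 0"
  obtains P Q where "basis_of {x \<in> C (Suc l). total x = 0} (P \<union> Q)" "P \<inter> Q = {}"
    "total ` C (Suc (Suc l)) = span ((*s) g ` P \<union> (*s) G ` Q)"
    "card Q = rank (D ` C (Suc (Suc l)))" "card P + card Q = rank (K (Suc l))"
proof -
  let ?Z = "{x \<in> C (Suc l). total x = 0}" and ?F = "\<lambda>x. D (\<delta> (s x))"
  obtain W T U where
    W: "basis_of {x \<in> K (Suc l). D x = 0} (W \<union> T)" "W \<inter> T = {}" and
    T: "basis_of (D ` K (Suc (Suc l))) T" and
    WTU: "basis_of (K (Suc l)) (W \<union> T \<union> U)" "(W \<union> T) \<inter> U = {}" and
    U: "U \<subseteq> K (Suc l)" "inj_on D U" "basis_of (D ` K (Suc l)) (D ` U)"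
    by (rule K_D_basis)
  have fin: "finite W" "finite T" "finite U"
    using WTU(1) by (auto simp: basis_of_def)
  have WT: "W \<union> T \<subseteq> {x \<in> K (Suc l). D x = 0}"
    using W(1) by (rule basis_of_subset)
  \<comment> \<open>\<open>?F\<close> takes a cycle \<open>k + s y\<close> to \<open>D k\<close>. Its kernel has the basis \<open>W \<union> T\<close> and its image \<open>(g / G) D U\<close>, which the lifts of \<open>U\<close> hit.\<close>
  have linF: "linear_map ?F"
    using module_hom_compose[OF linear_s module_hom_compose[OF linear_\<delta> linear_D]]
    by (simp add: o_def)
  have FL: "?F (lift u) = (g div G) *s D u" if "u \<in> U" for u
    using that U(1) by (auto simp: \<delta>_s_lift D.scale)
  have gU: "inj_on (\<lambda>u. (g div G) *s D u) U"
  proof (rule inj_onI)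
    fix u v assume uv: "u \<in> U" "v \<in> U" "(g div G) *s D u = (g div G) *s D v"
    then have "(g div G) *s (D u - D v) = 0" by (simp add: scale_right_diff_distrib)
    then have "D u = D v" using scale_eq_0D[OF _ g_div_G[OF g]] by fastforce
    then show "u = v" using U(2) uv by (auto dest: inj_onD)
  qed
  have injL: "inj_on lift U"
  proof (rule inj_onI)
    fix u v assume uv: "u \<in> U" "v \<in> U" "lift u = lift v"
    then have "(g div G) *s D u = (g div G) *s D v" using FL[of u] FL[of v] by simp
    then show "u = v" using uv inj_onD[OF gU] by blast
  qed
  have 1: "basis_of {x \<in> ?Z. ?F x = 0} (W \<union> T)"
    using W(1) cycle_kernel[OF g] by simp
  have 2: "basis_of (?F ` ?Z) ((*s) (g div G) ` D ` U)"
    using basis_of_scale[OF U(3) g_div_G[OF g]] cycle_image[OF g] by simp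
  have 3: "lift ` U \<subseteq> ?Z"
    using U(1) lift_closed total_lift by blast
  have 4: "inj_on ?F (lift ` U)"
  proof (rule inj_onI)
    fix x y assume xy: "x \<in> lift ` U" "y \<in> lift ` U" "?F x = ?F y"
    then obtain u v where uv: "u \<in> U" "v \<in> U" "x = lift u" "y = lift v" by blast
    then have "(g div G) *s D u = (g div G) *s D v" using xy(3) FL by simp
    then show "x = y" using uv inj_onD[OF gU] by blast
  qed
  have 5: "?F ` lift ` U = (*s) (g div G) ` D ` U"
    using FL by (auto simp: image_image)
  have Z: "basis_of ?Z (W \<union> T \<union> lift ` U)" "(W \<union> T) \<inter> lift ` U = {}"
    by (rule basis_of_kernel_Un_lift[OF linF subspace_kernel_in[OF linear_total subspace_C] 1 2 3 4 5])+
  let ?B = "span ((*s) g ` W \<union> (*s) G ` (T \<union> lift ` U))"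
  have gG: "g *s x = (g div G) *s (G *s x)" for x
    using G_mult(1) by (simp add: mult.commute)
  have B1: "g *s x \<in> ?B" if "x \<in> W" for x
    using that by (intro span_base) auto
  have B2: "G *s x \<in> ?B" if "x \<in> T \<union> lift ` U" for x
    using that by (intro span_base) auto
  have GL: "G *s lift y \<in> ?B" if "y \<in> K (Suc l)" for y
  proof -
    have "y \<in> span (W \<union> T \<union> U)" using that WTU(1) by (simp add: basis_of_def)
    then show ?thesis
    proof (rule span_induct)
      have "linear_map (\<lambda>y. G *s lift y)"
        by unfold_locales (simp_all add: lift.add lift.scale scale_right_distrib mult.commute)
      then show "subspace {y. G *s lift y \<in> ?B}"
        by (rule module_hom.subspace_linear_preimage) simp
      show "G *s lift y \<in> ?B" if "y \<in> W \<union> T \<union> U" for y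
        using that
      proof (elim UnE)
        assume y: "y \<in> W"
        then show ?thesis using WT B1 by (auto simp: scale_G_lift s.zero)
      next
        assume y: "y \<in> T"
        then have "G *s lift y = (g div G) *s (G *s y)"
          using WT gG by (auto simp: scale_G_lift s.zero)
        moreover have "(g div G) *s (G *s y) \<in> ?B"
          by (rule span_scale) (use B2 y in blast)
        ultimately show ?thesis by simp
      next
        assume "y \<in> U" then show ?thesis using B2 by blast
      qed
    qed
  qed
  have dT: "d *s y \<in> ?B" if "y \<in> D ` K (Suc (Suc l))" for y
  proof -
    have "y \<in> span T" using that T by (simp add: basis_of_def)
    then have "G *s y \<in> ?B"
    proof (rule span_induct)
      show "subspace {y. G *s y \<in> ?B}"
        by (rule module_hom.subspace_linear_preimage[of scale scale]) simp_all
    qed (use B2 in blast)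
    then have "(d div G) *s (G *s y) \<in> ?B" by (rule span_scale)
    then show ?thesis using G_mult(2) by (simp add: mult.commute)
  qed
  have "total ` C (Suc (Suc l)) = ?B"
  proof
    show "total ` C (Suc (Suc l)) \<subseteq> ?B"
    proof safe
      fix x assume x: "x \<in> C (Suc (Suc l))"
      have "\<delta> x \<in> K (Suc l)" using x \<delta>_image by blast
      then show "total x \<in> ?B"
        using total_decompose[OF x] dT GL \<delta>_s_closed[OF x] span_add by auto
    qed
    have s_cyc: "total (s y) = G *s lift y" "total (s y) \<in> total ` C (Suc (Suc l))"
      if "y \<in> K (Suc l)" for y
      using that total_s s_closed K_C by blast+
    have "(*s) g ` W \<union> (*s) G ` (T \<union> lift ` U) \<subseteq> total ` C (Suc (Suc l))"
    proof safe
      fix w assume w: "w \<in> W"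
      then have "total (s w) = g *s w"
        using s_cyc(1)[of w] WT by (auto simp: scale_G_lift s.zero)
      then show "g *s w \<in> total ` C (Suc (Suc l))"
        using s_cyc(2)[of w] w WT by auto
    next
      fix t assume t: "t \<in> T"
      obtain \<gamma> \<eta> where b: "\<gamma> * g + \<eta> * d = G" using G_bezout[OF g] by blast
      have "t \<in> D ` K (Suc (Suc l))"
        using t basis_of_subset[OF T] by blast
      then obtain k where k: "k \<in> K (Suc (Suc l))" "t = D k" by blast
      have "total (s t) = g *s t"
        using s_cyc(1)[of t] t WT by (auto simp: scale_G_lift s.zero)
      moreover have "total k = d *s t"
        using k by (simp add: total_def K_def)
      ultimately have "total (\<gamma> *s s t + \<eta> *s k) = (\<gamma> * g + \<eta> * d) *s t"
        by (simp add: total.add total.scale scale_left_distrib)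
      moreover have "\<gamma> *s s t + \<eta> *s k \<in> C (Suc (Suc l))"
        using t WT k(1) K_C s_closed by (intro subspace_add subspace_scale subspace_C) blast+
      ultimately show "G *s t \<in> total ` C (Suc (Suc l))"
        using b by (metis image_eqI)
    next
      fix u assume "u \<in> U"
      then show "G *s lift u \<in> total ` C (Suc (Suc l))"
        using s_cyc U(1) by (metis subsetD)
    qed
    then show "?B \<subseteq> total ` C (Suc (Suc l))"
      using total.subspace_image[OF subspace_C] span_minimal by blast
  qed
  moreover have disj: "T \<inter> lift ` U = {}" "W \<inter> (T \<union> lift ` U) = {}"
    using Z(2) W(2) by auto
  have cU: "card (lift ` U) = card U" using injL card_image by blast
  have cQ: "card (T \<union> lift ` U) = card T + card U"
    using fin disj cU by (simp add: card_Un_disjoint)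
  have "card T = rank (D ` K (Suc (Suc l)))" "card U = rank (D ` K (Suc l))"
    using rank_eq_card[OF T] rank_eq_card[OF U(3)] card_image[OF U(2)] by simp_all
  then have "card (T \<union> lift ` U) = rank (D ` C (Suc (Suc l)))"
    using cQ rank_D_K_add[of "Suc l"] by simp
  moreover have "card W + card (T \<union> lift ` U) = rank (K (Suc l))"
    using rank_eq_card[OF WTU(1)] cQ fin W(2) WTU(2) by (simp add: card_Un_disjoint)
  ultimately show ?thesis
    using that[of W "T \<union> lift ` U"] Z(1) disj(2) by (simp add: Un_assoc)
qed

end

section \<open>Operators on tuples\<close>

interpretation frag: torsion_free_int_module "frag_cmul :: int \<Rightarrow> ('c \<Rightarrow>\<^sub>0 int) \<Rightarrow> _"
  by unfold_locales (auto simp: frag_cmul_distrib frag_cmul_distrib2)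

(* Together with minus_frag_cmul these two would rewrite back and forth. *)
declare frag.scale_minus_left [simp del] frag.scale_minus_right [simp del]

lemma linear_frag_extend: "frag.linear_map (frag_extend b)"
  by unfold_locales (auto simp: frag_extend_add frag_extend_cmul)

definition tuples :: "'a set \<Rightarrow> nat \<Rightarrow> 'a list set" where
  "tuples X l = {xs. length xs = l \<and> set xs \<subseteq> X}"

definition chains :: "'a set \<Rightarrow> nat \<Rightarrow> ('a list \<Rightarrow>\<^sub>0 int) set" where
  "chains X l = {c. Poly_Mapping.keys c \<subseteq> tuples X l}"

text \<open>
  On a tuple of length one this is the empty tuple rather than zero. With this augmentation the homotopy
  formula for appending holds for all lists, and on reduced chains of degree zero the augmentation vanishes.
\<close>

definition boundary_op :: "('a \<Rightarrow> 'a \<Rightarrow> 'a) \<Rightarrow> ('a list \<Rightarrow>\<^sub>0 int) \<Rightarrow> ('a list \<Rightarrow>\<^sub>0 int)" where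
  "boundary_op f =
     frag_extend (\<lambda>xs. \<Sum>i<length xs. frag_cmul ((-1) ^ i) (frag_of (face_map f i xs)))"

definition act :: "('a \<Rightarrow> 'a \<Rightarrow> 'a) \<Rightarrow> 'a \<Rightarrow> ('a list \<Rightarrow>\<^sub>0 int) \<Rightarrow> ('a list \<Rightarrow>\<^sub>0 int)" where
  "act f y = frag_extend (\<lambda>xs. frag_of (map (\<lambda>x. f x y) xs))"

definition append_op :: "'a \<Rightarrow> ('a list \<Rightarrow>\<^sub>0 int) \<Rightarrow> ('a list \<Rightarrow>\<^sub>0 int)" where
  "append_op y = frag_extend (\<lambda>xs. frag_cmul ((-1) ^ length xs) (frag_of (xs @ [y])))"

definition dup_op :: "('a list \<Rightarrow>\<^sub>0 int) \<Rightarrow> ('a list \<Rightarrow>\<^sub>0 int)" where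
  "dup_op = frag_extend (\<lambda>xs. frag_of (take 1 xs @ xs))"

definition tl_op :: "('a list \<Rightarrow>\<^sub>0 int) \<Rightarrow> ('a list \<Rightarrow>\<^sub>0 int)" where
  "tl_op = frag_extend (\<lambda>xs. frag_of (tl xs))"

lemmas op_defs = boundary_op_def act_def append_op_def dup_op_def tl_op_def

lemma linear_ops:
  "frag.linear_map (boundary_op f)" "frag.linear_map (act f y)" "frag.linear_map (append_op y)"
  "frag.linear_map dup_op" "frag.linear_map tl_op"
  by (simp_all add: op_defs linear_frag_extend)

interpretation boundary_op: module_hom frag_cmul frag_cmul "boundary_op f" by (rule linear_ops)
interpretation act: module_hom frag_cmul frag_cmul "act f y" by (rule linear_ops)
interpretation append_op: module_hom frag_cmul frag_cmul "append_op y" by (rule linear_ops)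
interpretation dup_op: module_hom frag_cmul frag_cmul dup_op by (rule linear_ops)
interpretation tl_op: module_hom frag_cmul frag_cmul tl_op by (rule linear_ops)

lemmas op_simps =
  boundary_op.add act.add append_op.add dup_op.add tl_op.add
  boundary_op.diff act.diff append_op.diff dup_op.diff tl_op.diff
  boundary_op.neg act.neg append_op.neg dup_op.neg tl_op.neg
  boundary_op.zero act.zero append_op.zero dup_op.zero tl_op.zero
  boundary_op.scale act.scale append_op.scale dup_op.scale tl_op.scale
  boundary_op.sum act.sum append_op.sum dup_op.sum tl_op.sum

lemma op_frag_of:
  "boundary_op f (frag_of xs) = (\<Sum>i<length xs. frag_cmul ((-1) ^ i) (frag_of (face_map f i xs)))"
  "act f y (frag_of xs) = frag_of (map (\<lambda>x. f x y) xs)"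
  "append_op y (frag_of xs) = frag_cmul ((-1) ^ length xs) (frag_of (xs @ [y]))"
  "dup_op (frag_of xs) = frag_of (take 1 xs @ xs)"
  "tl_op (frag_of xs) = frag_of (tl xs)"
  by (simp_all add: op_defs)

lemma frag_of_in_chains [simp]: "frag_of xs \<in> chains X l \<longleftrightarrow> xs \<in> tuples X l"
  by (simp add: chains_def)

lemma subspace_chains: "frag.subspace (chains X l)"
proof (rule frag.subspaceI)
  show "x + y \<in> chains X l" if "x \<in> chains X l" "y \<in> chains X l" for x y
    using that Poly_Mapping.keys_add[of x y] by (auto simp: chains_def)
  show "frag_cmul c x \<in> chains X l" if "x \<in> chains X l" for c x
    using that keys_cmul[of c x] by (auto simp: chains_def)
qed (simp add: chains_def)

lemma chains_induct [consumes 1, case_names zero tuple diff]: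
  assumes "c \<in> chains X l" "P 0" "\<And>xs. length xs = l \<Longrightarrow> set xs \<subseteq> X \<Longrightarrow> P (frag_of xs)"
    "\<And>a b. P a \<Longrightarrow> P b \<Longrightarrow> P (a - b)"
  shows "P c"
  using assms(1) unfolding chains_def mem_Collect_eq
  by (rule frag_induction) (use assms in \<open>auto simp: tuples_def\<close>)

text \<open>
  Closure properties of chain groups only have to be checked on tuples.
\<close>

lemma linear_chains_closed:
  assumes F: "frag.linear_map F" and c: "c \<in> chains X l" and S: "frag.subspace S"
    and "\<And>xs. length xs = l \<Longrightarrow> set xs \<subseteq> X \<Longrightarrow> F (frag_of xs) \<in> S"
  shows "F c \<in> S"
proof -
  interpret F: module_hom frag_cmul frag_cmul F by fact
  show ?thesis
    using c by (induction rule: chains_induct)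
      (auto simp: F.zero F.diff assms frag.subspace_0[OF S] frag.subspace_diff[OF S])
qed

lemma chains_basis: 
  assumes "finite X"
  shows "frag.basis_of (chains X l) (frag_of ` tuples X l)"
  unfolding frag.basis_of_def
proof (intro conjI)
  show fin: "finite (frag_of ` tuples X l)"
    using finite_lists_length_eq[OF assms, of l] by (simp add: tuples_def conj_commute)
  have inj: "inj_on frag_of (tuples X l)"
    by (auto simp: inj_on_def frag_of_eq)
  show "frag.independent (frag_of ` tuples X l :: ('a list \<Rightarrow>\<^sub>0 int) set)"
  proof (rule frag.independentI_finite[OF fin], intro ballI)
    fix c :: "('a list \<Rightarrow>\<^sub>0 int) \<Rightarrow> int" and v
    assume "(\<Sum>v\<in>frag_of ` tuples X l. frag_cmul (c v) v) = 0" and v: "v \<in> frag_of ` tuples X l"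
    then have z: "(\<Sum>xs\<in>tuples X l. frag_cmul (c (frag_of xs)) (frag_of xs)) = 0"
      by (simp add: sum.reindex[OF inj])
    obtain ys where ys: "ys \<in> tuples X l" "v = frag_of ys" using v by blast
    have "Poly_Mapping.lookup (\<Sum>xs\<in>tuples X l. frag_cmul (c (frag_of xs)) (frag_of xs)) ys
        = (\<Sum>xs\<in>tuples X l. c (frag_of xs) * (if xs = ys then 1 else 0))"
      by (simp add: lookup_sum eq_commute)
    also have "\<dots> = c v"
      using ys finite_imageD[OF fin inj] by (simp add: if_distrib cong: if_cong)
    finally show "c v = 0"
      using z by simp
  qed
  show "frag.span (frag_of ` tuples X l) = chains X l"
  proof (rule frag.span_subspace[OF _ _ subspace_chains])
    show "chains X l \<subseteq> frag.span (frag_of ` tuples X l)"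
    proof
      fix c assume "c \<in> chains X l"
      then show "c \<in> frag.span (frag_of ` tuples X l)"
        by (induction rule: chains_induct)
          (auto simp: frag.span_zero frag.span_diff tuples_def intro: frag.span_base)
    qed
  qed auto
qed

lemma rank_chains: "finite X \<Longrightarrow> frag.rank (chains X l) = card X ^ l"
  using frag.rank_eq_card[OF chains_basis] card_lists_length_eq[of X l]
  by (subst frag.rank_eq_card[OF chains_basis])
     (auto simp: card_image inj_on_def frag_of_eq tuples_def conj_commute)

lemma length_face_map: "i < length xs \<Longrightarrow> length (face_map f i xs) = length xs - 1"
  by (simp add: face_map_def)

lemma set_face_map:
  assumes "\<And>x y. x \<in> X \<Longrightarrow> y \<in> X \<Longrightarrow> f x y \<in> X" "set xs \<subseteq> X" "i < length xs"
  shows "set (face_map f i xs) \<subseteq> X"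
  using assms(2,3) by (auto simp: face_map_def dest: in_set_takeD in_set_dropD intro!: assms(1))

lemma face_map_snoc:
  "i < length xs \<Longrightarrow> face_map f i (xs @ [y]) = face_map f i xs @ [y]"
  "face_map f (length xs) (xs @ [y]) = map (\<lambda>x. f x y) xs"
  by (auto simp: face_map_def nth_append)

lemma face_map_map:
  assumes "i < length xs" "set xs \<subseteq> X"
    "\<And>x z. x \<in> X \<Longrightarrow> z \<in> X \<Longrightarrow> h (g x z) = g (h x) (h z)"
  shows "map h (face_map g i xs) = face_map g i (map h xs)"
proof -
  have "h (g x (xs ! i)) = g (h x) (h (xs ! i))" if "x \<in> set (take i xs)" for x
    using assms(1,2) that by (intro assms(3)) (auto dest: in_set_takeD)
  then show ?thesis
    using assms(1) by (simp add: face_map_def take_map drop_map)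
qed

lemma boundary_op_closed:
  assumes f: "\<And>x y. x \<in> X \<Longrightarrow> y \<in> X \<Longrightarrow> f x y \<in> X" and c: "c \<in> chains X l"
  shows "boundary_op f c \<in> chains X (l - 1)"
proof (rule linear_chains_closed[OF linear_ops(1) c subspace_chains])
  fix xs assume xs: "length xs = l" "set xs \<subseteq> X"
  have "frag_of (face_map f i xs) \<in> chains X (l - 1)" if "i < length xs" for i
    using xs that set_face_map[OF f] length_face_map by (auto simp: tuples_def)
  then show "boundary_op f (frag_of xs) \<in> chains X (l - 1)"
    unfolding op_frag_of by (intro frag.subspace_sum frag.subspace_scale subspace_chains) simp
qed

lemma append_op_closed:
  assumes "y \<in> X" "c \<in> chains X l"
  shows "append_op y c \<in> chains X (Suc l)"
  by (rule linear_chains_closed[OF linear_ops(3) assms(2) subspace_chains])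
     (use assms(1) in \<open>auto simp: op_frag_of tuples_def intro!: frag.subspace_scale[OF subspace_chains]\<close>)

lemma dup_op_closed: "c \<in> chains X (Suc l) \<Longrightarrow> dup_op c \<in> chains X (Suc (Suc l))"
  by (rule linear_chains_closed[OF linear_ops(4) _ subspace_chains])
     (auto simp: op_frag_of tuples_def dest: in_set_takeD)

lemma tl_op_closed: "c \<in> chains X (Suc l) \<Longrightarrow> tl_op c \<in> chains X l"
  by (rule linear_chains_closed[OF linear_ops(5) _ subspace_chains])
     (auto simp: op_frag_of tuples_def dest: list.set_sel(2)[rotated])

lemma act_closed:
  assumes "y \<in> X" "\<And>x. x \<in> X \<Longrightarrow> f x y \<in> Y" "c \<in> chains X l"
  shows "act f y c \<in> chains Y l"
  by (rule linear_chains_closed[OF linear_ops(2) assms(3) subspace_chains])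
     (use assms(1,2) in \<open>auto simp: op_frag_of tuples_def\<close>)

lemma frag_ext_induct [case_names zero of diff]:
  assumes "P 0" "\<And>x. P (frag_of x)" "\<And>a b. P a \<Longrightarrow> P b \<Longrightarrow> P (a - b)"
  shows "P (c :: 'c \<Rightarrow>\<^sub>0 int)"
  using subset_UNIV by (rule frag_induction) (use assms in auto)

text \<open>
  A face of \<open>xs @ [y]\<close> is a face of \<open>xs\<close> with \<open>y\<close> appended, except for the last one, in which \<open>y\<close> acts on \<open>xs\<close>.
\<close>

lemma boundary_append:
  "boundary_op f (append_op y c) = act f y c - append_op y (boundary_op f c)"
proof (induction c rule: frag_ext_induct)
  case (of xs)
  let ?n = "length xs"
  have sign: "(-1) ^ ?n * (-1 :: int) ^ i = - ((-1) ^ i * (-1) ^ (?n - 1))" if "i < ?n" for i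
    using that by (cases ?n) auto
  have "boundary_op f (append_op y (frag_of xs))
      = (\<Sum>i<?n. frag_cmul ((-1) ^ ?n * (-1) ^ i) (frag_of (face_map f i xs @ [y])))
        + frag_cmul ((-1) ^ ?n * (-1) ^ ?n) (frag_of (map (\<lambda>x. f x y) xs))"
    by (simp add: op_frag_of op_simps face_map_snoc frag_cmul_distrib2 frag_cmul_sum)
  also have "(-1) ^ ?n * (-1 :: int) ^ ?n = 1"
    by (simp flip: power_mult_distrib)
  also have "(\<Sum>i<?n. frag_cmul ((-1) ^ ?n * (-1) ^ i) (frag_of (face_map f i xs @ [y])))
      = (\<Sum>i<?n. - append_op y (frag_cmul ((-1) ^ i) (frag_of (face_map f i xs))))"
  proof (rule sum.cong[OF refl])
    fix i assume "i \<in> {..<?n}"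
    then have i: "i < ?n" by simp
    show "frag_cmul ((-1) ^ ?n * (-1) ^ i) (frag_of (face_map f i xs @ [y]))
        = - append_op y (frag_cmul ((-1) ^ i) (frag_of (face_map f i xs)))"
      unfolding append_op.scale op_frag_of sign[OF i] length_face_map[OF i] by simp
  qed
  also have "\<dots> = - append_op y (boundary_op f (frag_of xs))"
    by (simp only: op_frag_of append_op.sum sum_negf)
  finally show ?case
    by (simp add: op_frag_of)
qed (simp_all add: op_simps)

lemma boundary_act:
  assumes y: "y \<in> X" and c: "c \<in> chains X l"
    and hom: "\<And>x z. x \<in> X \<Longrightarrow> z \<in> X \<Longrightarrow> f (g x z) y = g (f x y) (f z y)"
  shows "boundary_op g (act f y c) = act f y (boundary_op g c)"
  using c
proof (induction rule: chains_induct)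
  case (tuple xs)
  show ?case
    unfolding op_frag_of op_simps length_map
    using tuple face_map_map[of _ xs X "\<lambda>x. f x y" g] hom
    by (intro sum.cong) (auto simp: op_simps op_frag_of)
qed (simp_all add: op_simps)

text \<open>
  By induction on the length, without manipulating double sums: appending the last entry anticommutes with both
  boundaries up to an action of that entry, and an action that is a homomorphism for the other
  operation commutes with its boundary.
\<close>

lemma boundary_anticommute:
  assumes closed: "\<And>x y. x \<in> X \<Longrightarrow> y \<in> X \<Longrightarrow> f x y \<in> X" "\<And>x y. x \<in> X \<Longrightarrow> y \<in> X \<Longrightarrow> g x y \<in> X"
    and fg: "\<And>x y z. x \<in> X \<Longrightarrow> y \<in> X \<Longrightarrow> z \<in> X \<Longrightarrow> f (g x z) y = g (f x y) (f z y)"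
    and gf: "\<And>x y z. x \<in> X \<Longrightarrow> y \<in> X \<Longrightarrow> z \<in> X \<Longrightarrow> g (f x z) y = f (g x y) (g z y)"
    and c: "c \<in> chains X l"
  shows "boundary_op f (boundary_op g c) = - boundary_op g (boundary_op f c)"
  using c
proof (induction l arbitrary: c)
  case 0
  then show ?case
    by (induction rule: chains_induct) (simp_all add: op_simps op_frag_of)
next
  case (Suc l)
  show ?case
    using Suc.prems
  proof (induction rule: chains_induct)
    case (tuple zs)
    then obtain xs y where zs: "zs = xs @ [y]" "length xs = l" "set xs \<subseteq> X" "y \<in> X"
      by (cases zs rule: rev_cases) auto
    \<comment> \<open>The sign cancels the one in \<open>append_op\<close>.\<close>
    let ?c = "frag_cmul ((-1) ^ length xs) (frag_of xs)"
    have c: "?c \<in> chains X l"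
      using zs by (intro frag.subspace_scale subspace_chains) (simp add: tuples_def)
    have *: "frag_of zs = append_op y ?c"
      by (simp add: zs op_simps op_frag_of flip: power_mult_distrib)
    have "boundary_op f (boundary_op g (frag_of zs)) + boundary_op g (boundary_op f (frag_of zs))
      = append_op y (boundary_op f (boundary_op g ?c) + boundary_op g (boundary_op f ?c))"
      unfolding * boundary_append boundary_op.diff append_op.add
      using boundary_act[OF zs(4) c, of f g] boundary_act[OF zs(4) c, of g f] fg gf zs(4) by simp
    also have "boundary_op f (boundary_op g ?c) + boundary_op g (boundary_op f ?c) = 0"
      by (subst Suc.IH[OF c]) (rule left_minus)
    also have "append_op y 0 = 0"
      by (rule append_op.zero)
    finally show ?case
      by (simp add: eq_neg_iff_add_eq_0)
  qed (simp_all add: op_simps)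
qed

lemma face_map_right:
  "i < length xs \<Longrightarrow> face_map (\<lambda>x y. y) i xs = replicate i (xs ! i) @ drop (Suc i) xs"
  by (simp add: face_map_def map_replicate_const)

text \<open>
  For the operation \<open>x \<stileturn> y = y\<close> the faces \<open>0\<close> and \<open>1\<close> of a tuple agree and cancel. In \<open>x # x # ys\<close> the remaining faces are
  the doubled faces of \<open>x # ys\<close> other than face \<open>0\<close>, shifted by one index and hence with opposite sign.
\<close>

lemma dup_boundary:
  assumes "c \<in> chains X (Suc l)"
  shows "dup_op (boundary_op (\<lambda>x y. y) c) + boundary_op (\<lambda>x y. y) (dup_op c) = dup_op (tl_op c)"
  using assms
proof (induction rule: chains_induct)
  case (tuple xs)
  then obtain x ys where xs: "xs = x # ys" by (cases xs) auto
  let ?v = "\<lambda>i. frag_cmul ((-1) ^ i) (frag_of (replicate (Suc (Suc i)) (ys ! i) @ drop (Suc i) ys))"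
  have "boundary_op (\<lambda>x y. y) (dup_op (frag_of xs)) = (\<Sum>i<length ys. ?v i)"
    unfolding xs op_frag_of
    by (simp add: sum.lessThan_Suc_shift face_map_right del: sum.lessThan_Suc)
  moreover have "dup_op (boundary_op (\<lambda>x y. y) (frag_of xs))
      = dup_op (frag_of ys) - (\<Sum>i<length ys. ?v i)"
    unfolding xs op_frag_of
    by (simp add: sum.lessThan_Suc_shift face_map_right op_simps op_frag_of sum_negf[symmetric]
        del: sum.lessThan_Suc)
  ultimately show ?case
    by (simp add: xs op_frag_of)
qed (simp_all add: op_simps algebra_simps)

lemma tl_dup: "tl_op (dup_op c) = c"
proof (induction c rule: frag_ext_induct)
  case (of xs)
  then show ?case by (cases xs) (simp_all add: op_frag_of)
qed (simp_all add: op_simps)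

text \<open>
  After faces \<open>0\<close> and \<open>1\<close> have cancelled, the remaining faces start with two equal entries.
\<close>

lemma dup_tl_boundary: "dup_op (tl_op (boundary_op (\<lambda>x y. y) c)) = boundary_op (\<lambda>x y. y) c"
proof (induction c rule: frag_ext_induct)
  case (of xs)
  show ?case
  proof (cases "length xs")
    case (Suc m)
    show ?thesis
    proof (cases m)
      case 0
      then show ?thesis using Suc by (simp add: op_frag_of op_simps face_map_def)
    next
      case (Suc k)
      then obtain x y ys where xs: "xs = x # y # ys"
        using \<open>length xs = Suc m\<close> by (metis length_Suc_conv)
      have "boundary_op (\<lambda>x y. y) (frag_of xs)
        = (\<Sum>i<length ys. frag_cmul ((-1) ^ i) (frag_of (replicate (Suc (Suc i)) (ys ! i) @ drop (Suc i) ys)))"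
        unfolding xs op_frag_of
        by (simp add: sum.lessThan_Suc_shift face_map_right del: sum.lessThan_Suc)
      then show ?thesis
        by (simp add: op_simps op_frag_of)
    qed
  qed (simp add: op_frag_of op_simps)
qed (simp_all add: op_simps)

lemma eq_neg_self: "x = - x \<Longrightarrow> x = (0 :: 'c \<Rightarrow>\<^sub>0 int)"
proof -
  assume "x = - x"
  then have "frag_cmul 2 x = 0"
    using frag_cmul_distrib[of 1 1 x] by (simp add: eq_neg_iff_add_eq_0)
  then show ?thesis by simp
qed

section \<open>The operators on reduced chains of a spindle with projector and unit\<close>

locale projector_unit_spindle = spindle X star
  for X :: "'a set" and star :: "'a \<Rightarrow> 'a \<Rightarrow> 'a" (infixl "\<star>" 70) +
  fixes p u :: 'a
  assumes finite_X: "finite X" and p_in: "p \<in> X" and u_in: "u \<in> X"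
    and right_projector: "x \<in> X \<Longrightarrow> x \<star> p = p"
    and right_unit: "x \<in> X \<Longrightarrow> x \<star> u = x"
begin

abbreviation "bdL \<equiv> boundary_op (\<lambda>x y :: 'a. x)"
abbreviation "bdS \<equiv> boundary_op star"
abbreviation "bdR \<equiv> boundary_op (\<lambda>x y :: 'a. y)"
abbreviation "collapse \<equiv> act (\<lambda>x y :: 'a. y) p"

text \<open>
  The kernel of the collapse onto \<open>C({p})\<close>, in tuple length \<open>l\<close>; it equals the chains of coefficient sum zero.
\<close>

definition reduced :: "nat \<Rightarrow> ('a list \<Rightarrow>\<^sub>0 int) set" where
  "reduced l = {c \<in> chains X l. collapse c = 0}"

lemma reduced_chains: "c \<in> reduced l \<Longrightarrow> c \<in> chains X l"
  by (simp add: reduced_def)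

lemma subspace_reduced: "frag.subspace (reduced l)"
  unfolding reduced_def by (rule frag.subspace_kernel_in[OF linear_ops(2) subspace_chains])

lemma reduced_has_basis: "\<exists>A. frag.basis_of (reduced l) A"
  using frag.subspace_of_has_basis[OF chains_basis[OF finite_X] subspace_reduced] reduced_chains
  by blast

lemma collapse_chains:
  assumes "c \<in> chains X l"
  shows "collapse c \<in> frag.span {frag_of (replicate l p)}"
  by (rule linear_chains_closed[OF linear_ops(2) assms])
     (auto simp: op_frag_of map_replicate_const intro: frag.span_base)

lemma rank_reduced: "frag.rank (reduced l) + 1 = card X ^ l"
proof -
  let ?t = "frag_of (replicate l p)"
  have t: "?t \<in> chains X l" using p_in by (auto simp: tuples_def)
  have "collapse ` chains X l = frag.span {?t}"
  proof
    show "collapse ` chains X l \<subseteq> frag.span {?t}" using collapse_chains by blast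
    have "collapse ?t = ?t" by (simp add: op_frag_of map_replicate_const)
    then have "?t \<in> collapse ` chains X l" using t by (metis imageI)
    then show "frag.span {?t} \<subseteq> collapse ` chains X l"
      by (intro frag.span_minimal act.subspace_image subspace_chains) simp
  qed
  moreover have "frag.basis_of (frag.span {?t}) {?t}"
    unfolding frag.basis_of_def
    using frag.independent_insertI[of "{}" ?t] frag.independent_empty by simp
  ultimately have "frag.rank (chains X l) = frag.rank (reduced l) + 1"
    unfolding reduced_def
    using frag.rank_nullity[OF linear_ops(2) chains_basis[OF finite_X], of "frag.span {?t}" "{?t}"
        "\<lambda>x y. y" p l]
      frag.rank_eq_card[of "frag.span {?t}" "{?t}"] by simp
  then show ?thesis using rank_chains[OF finite_X] by simp
qed

lemma reduced_0: "reduced 0 = {0}"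
proof -
  have "collapse c = c" if "c \<in> chains X 0" for c
    using that by (induction rule: chains_induct) (simp_all add: op_simps op_frag_of)
  then show ?thesis
    by (auto simp: reduced_def op_simps frag.subspace_0[OF subspace_chains])
qed

lemma boundary_reduced:
  assumes f: "\<And>x y. x \<in> X \<Longrightarrow> y \<in> X \<Longrightarrow> f x y \<in> X" "f p p = p" and c: "c \<in> reduced (Suc l)"
  shows "boundary_op f c \<in> reduced l"
proof -
  have "collapse (boundary_op f c) = boundary_op f (collapse c)"
    using c p_in f(2) by (intro boundary_act[symmetric, OF p_in]) (auto simp: reduced_def)
  then show ?thesis
    using c boundary_op_closed[OF f(1), where l = "Suc l"] by (auto simp: reduced_def op_simps)
qed

lemma append_reduced:
  assumes "y \<in> X" "c \<in> reduced l"
  shows "append_op y c \<in> reduced (Suc l)"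
proof -
  have "collapse (append_op y c) = append_op p (collapse c)" for c
    by (induction c rule: frag_ext_induct) (simp_all add: op_simps op_frag_of)
  then show ?thesis
    using assms append_op_closed by (auto simp: reduced_def op_simps)
qed

lemma dup_reduced:
  assumes "c \<in> reduced l"
  shows "dup_op c \<in> reduced (Suc l)"
proof -
  have "collapse (dup_op c) = dup_op (collapse c)" for c
    by (induction c rule: frag_ext_induct) (simp_all add: op_simps op_frag_of take_map)
  then have "collapse (dup_op c) = 0"
    using assms by (simp add: reduced_def op_simps)
  moreover have "dup_op c \<in> chains X (Suc l)"
  proof (cases l)
    case 0
    then show ?thesis
      using assms frag.subspace_0[OF subspace_chains] by (simp add: reduced_0 dup_op.zero)
  next
    case (Suc m)
    then show ?thesis
      using assms dup_op_closed reduced_chains by blast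
  qed
  ultimately show ?thesis
    by (simp add: reduced_def)
qed

lemma tl_reduced:
  assumes "c \<in> reduced (Suc l)"
  shows "tl_op c \<in> reduced l"
proof -
  have "collapse (tl_op c) = tl_op (collapse c)" for c
    by (induction c rule: frag_ext_induct) (simp_all add: op_simps op_frag_of map_tl)
  then show ?thesis
    using assms tl_op_closed by (auto simp: reduced_def op_simps)
qed

text \<open>
  The four right-hand sides of \<open>boundary_append\<close> on reduced chains.
\<close>

lemma act_eq:
  assumes "c \<in> reduced l"
  shows "act (\<lambda>x y. x) y c = c" "act (\<lambda>x y. y) y c = 0" "act star p c = 0" "act star u c = c"
proof -
  have c: "c \<in> chains X l" using assms reduced_chains by blast
  show "act (\<lambda>x y. x) y c = c"
    using c by (induction rule: chains_induct) (simp_all add: op_simps op_frag_of)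
  have "act (\<lambda>x y. y) y c = act (\<lambda>x y. y) y (collapse c)" for c
    by (induction c rule: frag_ext_induct) (simp_all add: op_simps op_frag_of o_def)
  from this[of c] show "act (\<lambda>x y. y) y c = 0"
    using assms by (simp add: reduced_def act.zero)
  have "act star p c = collapse c"
    using c
  proof (induction rule: chains_induct)
    case (tuple xs)
    then have "map (\<lambda>x. x \<star> p) xs = map (\<lambda>x. p) xs"
      using right_projector by (intro map_cong) auto
    then show ?case unfolding op_frag_of by (rule arg_cong)
  qed (simp_all add: op_simps)
  then show "act star p c = 0"
    using assms by (simp add: reduced_def)
  show "act star u c = c"
    using c
  proof (induction rule: chains_induct)
    case (tuple xs)
    then have "map (\<lambda>x. x \<star> u) xs = xs"
      using right_unit by (intro map_idI) auto
    then show ?case by (simp add: op_frag_of)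
  qed (simp_all add: op_simps)
qed

lemma anticommute:
  assumes "c \<in> chains X l"
  shows "bdR (bdR c) = - bdR (bdR c)" "bdL (bdL c) = - bdL (bdL c)" "bdS (bdS c) = - bdS (bdS c)"
    "bdL (bdS c) = - bdS (bdL c)" "bdL (bdR c) = - bdR (bdL c)" "bdS (bdR c) = - bdR (bdS c)"
  by (rule boundary_anticommute[OF _ _ _ _ assms];
      auto simp: closed idempotent intro: right_self_distributive)+

lemma square_zero:
  assumes "c \<in> chains X l"
  shows "bdR (bdR c) = 0" "bdL (bdL c) = 0" "bdS (bdS c) = 0"
proof -
  show "bdR (bdR c) = 0" by (rule eq_neg_self) (rule anticommute(1)[OF assms])
  show "bdL (bdL c) = 0" by (rule eq_neg_self) (rule anticommute(2)[OF assms])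
  show "bdS (bdS c) = 0" by (rule eq_neg_self) (rule anticommute(3)[OF assms])
qed

lemma retracted_complex_reduced: "retracted_complex frag_cmul reduced bdR dup_op tl_op"
proof (rule retracted_complex.intro[OF frag.torsion_free_int_module_axioms], rule retracted_complex_axioms.intro)
  show "\<exists>A. frag.basis_of (reduced l) A" for l by (rule reduced_has_basis)
  show "reduced 0 = {0}" by (rule reduced_0)
  show "bdR x \<in> reduced l" if "x \<in> reduced (Suc l)" for x l
    by (rule boundary_reduced[OF _ _ that]) simp_all
  show "dup_op x \<in> reduced (Suc l)" if "x \<in> reduced l" for x l
    using that by (rule dup_reduced)
  show "tl_op x \<in> reduced l" if "x \<in> reduced (Suc l)" for x l
    using that by (rule tl_reduced)
  show "bdR (bdR x) = 0" if "x \<in> reduced l" for x l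
    by (rule square_zero(1)[OF reduced_chains[OF that]])
  show "dup_op (bdR x) + bdR (dup_op x) = dup_op (tl_op x)" if "x \<in> reduced (Suc l)" for x l
    by (rule dup_boundary[OF reduced_chains[OF that]])
  show "frag.linear_map bdR" by (rule linear_ops(1))
  show "frag.linear_map (dup_op :: _ \<Rightarrow> 'a list \<Rightarrow>\<^sub>0 int)" by (rule linear_ops(4))
  show "frag.linear_map (tl_op :: _ \<Rightarrow> 'a list \<Rightarrow>\<^sub>0 int)" by (rule linear_ops(5))
  show "tl_op (dup_op x) = x" for x :: "'a list \<Rightarrow>\<^sub>0 int" by (rule tl_dup)
  show "dup_op (tl_op (bdR x)) = bdR x" for x :: "'a list \<Rightarrow>\<^sub>0 int" by (rule dup_tl_boundary)
qed

text \<open>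
  Here \<open>s = \<alpha> s\<^sub>p + \<beta> (s\<^sub>u - s\<^sub>p)\<close>. Since \<open>s\<^sub>p\<close> contracts \<open>\<partial>\<^sub>L\<close> and anticommutes with \<open>\<partial>\<^sub>S\<close>, and \<open>s\<^sub>u - s\<^sub>p\<close> does
  the reverse, \<open>\<delta> s + s \<delta>\<close> is the scalar \<open>\<alpha> a + \<beta> b\<close>.
\<close>

lemma contracted_complex_reduced:
  fixes a b \<alpha> \<beta> :: int
  assumes ab: "\<alpha> * a + \<beta> * b = 1"
  defines "\<delta> \<equiv> (\<lambda>c. frag_cmul a (bdL c) + frag_cmul b (bdS c))"
    and "s \<equiv> (\<lambda>c. frag_cmul (\<alpha> - \<beta>) (append_op p c) + frag_cmul \<beta> (append_op u c))"
  shows "contracted_complex frag_cmul reduced bdR dup_op tl_op \<delta> s"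
proof (rule contracted_complex.intro[OF retracted_complex_reduced], rule contracted_complex_axioms.intro)
  show "frag.linear_map \<delta>"
    unfolding \<delta>_def
    by unfold_locales (simp_all add: boundary_op.add boundary_op.scale frag_cmul_distrib2 mult.commute)
  show "frag.linear_map s"
    unfolding s_def
    by unfold_locales (simp_all add: append_op.add append_op.scale frag_cmul_distrib2 mult.commute)
  show "\<delta> x \<in> reduced l" if "x \<in> reduced (Suc l)" for x l
    unfolding \<delta>_def
    by (intro frag.subspace_add frag.subspace_scale subspace_reduced boundary_reduced[OF _ _ that])
      (auto simp: closed idempotent p_in)
  show "s x \<in> reduced (Suc l)" if "x \<in> reduced l" for x l
    unfolding s_def
    by (intro frag.subspace_add frag.subspace_scale subspace_reduced append_reduced[OF _ that] p_in u_in)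
  fix x l assume x: "x \<in> reduced l"
  then have c: "x \<in> chains X l" by (rule reduced_chains)
  show "\<delta> (\<delta> x) = 0"
    using square_zero[OF c] anticommute(4)[OF c]
    by (simp add: \<delta>_def boundary_op.add boundary_op.scale frag_cmul_distrib2 mult.commute
        frag.scale_minus_right del: minus_frag_cmul)
  show "\<delta> (bdR x) = - bdR (\<delta> x)"
    using anticommute(5,6)[OF c]
    by (simp add: \<delta>_def boundary_op.add boundary_op.scale frag.scale_minus_right)
  show "bdR (s x) = - s (bdR x)"
    using act_eq[OF x]
    by (simp add: s_def boundary_op.add boundary_op.scale boundary_append frag.scale_minus_right)
  show "\<delta> (s x) = x - s (\<delta> x)"
  proof (rule poly_mapping_eqI)
    have bdL_s: "bdL (s x) = frag_cmul (\<alpha> - \<beta>) (x - append_op p (bdL x))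
        + frag_cmul \<beta> (x - append_op u (bdL x))"
      using act_eq[OF x] by (simp add: s_def boundary_op.add boundary_op.scale boundary_append)
    have bdS_s: "bdS (s x) = frag_cmul (\<alpha> - \<beta>) (- append_op p (bdS x))
        + frag_cmul \<beta> (x - append_op u (bdS x))"
      using act_eq[OF x] by (simp add: s_def boundary_op.add boundary_op.scale boundary_append)
    fix i :: "'a list"
    let ?v = "\<lambda>c :: 'a list \<Rightarrow>\<^sub>0 int. Poly_Mapping.lookup c i"
    have "?v (\<delta> (s x)) = (a * (\<alpha> - \<beta>) + a * \<beta> + b * \<beta>) * ?v x
        - a * (\<alpha> - \<beta>) * ?v (append_op p (bdL x)) - a * \<beta> * ?v (append_op u (bdL x))
        - b * (\<alpha> - \<beta>) * ?v (append_op p (bdS x)) - b * \<beta> * ?v (append_op u (bdS x))"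
      unfolding \<delta>_def bdL_s bdS_s
      by (simp add: lookup_add lookup_minus algebra_simps)
    moreover have "?v (s (\<delta> x)) =
        a * (\<alpha> - \<beta>) * ?v (append_op p (bdL x)) + a * \<beta> * ?v (append_op u (bdL x))
        + b * (\<alpha> - \<beta>) * ?v (append_op p (bdS x)) + b * \<beta> * ?v (append_op u (bdS x))"
      by (simp add: \<delta>_def s_def append_op.add append_op.scale lookup_add lookup_minus algebra_simps)
    moreover have "a * (\<alpha> - \<beta>) + a * \<beta> + b * \<beta> = 1"
      using ab by (simp add: algebra_simps)
    ultimately show "?v (\<delta> (s x)) = ?v (x - s (\<delta> x))"
      by (simp add: lookup_minus)
  qed
qed

end

section \<open>Relative homology as homology of reduced chains\<close>

context projector_unit_spindle
begin

definition total_boundary :: "int \<Rightarrow> int \<Rightarrow> int \<Rightarrow> ('a list \<Rightarrow>\<^sub>0 int) \<Rightarrow> ('a list \<Rightarrow>\<^sub>0 int)" where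
  "total_boundary a b d c = frag_cmul a (bdL c) + frag_cmul b (bdS c) + frag_cmul d (bdR c)"

lemma linear_total_boundary: "frag.linear_map (total_boundary a b d)"
  unfolding total_boundary_def
  by unfold_locales
    (simp_all add: boundary_op.add boundary_op.scale frag_cmul_distrib2 mult.commute)

lemma total_boundary_reduced:
  assumes "z \<in> reduced (Suc l)"
  shows "total_boundary a b d z \<in> reduced l"
  unfolding total_boundary_def
  by (intro frag.subspace_add frag.subspace_scale subspace_reduced boundary_reduced[OF _ _ assms])
    (auto simp: closed idempotent p_in)

lemma total_boundary_square_zero:
  assumes "z \<in> reduced l"
  shows "total_boundary a b d (total_boundary a b d z) = 0"
  using square_zero[OF reduced_chains[OF assms]] anticommute(4-6)[OF reduced_chains[OF assms]]
  by (simp add: total_boundary_def boundary_op.add boundary_op.scale frag_cmul_distrib2 mult.commute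
      frag.scale_minus_right frag.scale_right_diff_distrib del: minus_frag_cmul)

lemma carrier_tuple_chains: "carrier (tuple_chains Y n) = chains Y (Suc n)"
  by (simp add: tuple_chains_def chains_def tuples_def free_Abelian_group_def)

lemma mult_tuple_chains: "x \<otimes>\<^bsub>tuple_chains Y n\<^esub> y = x + y"
  by (simp add: tuple_chains_def)

lemma three_term_boundary_eq:
  assumes z: "z \<in> reduced (Suc n)"
  shows "three_term_boundary star a b d n z = total_boundary a b d z"
proof (cases "n = 0")
  case True
  then have "total_boundary a b d z = 0"
    using total_boundary_reduced[OF z] reduced_0 by simp
  then show ?thesis
    using True by (simp add: three_term_boundary_def one_term_boundary_def)
next
  case False
  have "one_term_boundary f n z = boundary_op f z" for f :: "'a \<Rightarrow> 'a \<Rightarrow> 'a"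
  proof -
    have "length xs = Suc n" if "xs \<in> Poly_Mapping.keys z" for xs
      using that reduced_chains[OF z] by (auto simp: chains_def tuples_def)
    then show ?thesis
      using False unfolding one_term_boundary_def boundary_op_def
      by (auto intro!: frag_extend_eq simp: atLeast0AtMost lessThan_Suc_atMost)
  qed
  then show ?thesis
    by (simp add: three_term_boundary_def total_boundary_def)
qed

definition coset :: "nat \<Rightarrow> ('a list \<Rightarrow>\<^sub>0 int) \<Rightarrow> ('a list \<Rightarrow>\<^sub>0 int) set" where
  "coset n z = carrier (tuple_chains {p} n) #>\<^bsub>tuple_chains X n\<^esub> z"

lemma coset_eq: "coset n z = (\<lambda>w. w + z) ` chains {p} (Suc n)"
  by (auto simp: coset_def r_coset_def mult_tuple_chains carrier_tuple_chains)

lemma coset_add: "coset n x <#>\<^bsub>tuple_chains X n\<^esub> coset n y = coset n (x + y)"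
proof
  show "coset n x <#>\<^bsub>tuple_chains X n\<^esub> coset n y \<subseteq> coset n (x + y)"
  proof
    fix v assume "v \<in> coset n x <#>\<^bsub>tuple_chains X n\<^esub> coset n y"
    then obtain w w' where w: "w \<in> chains {p} (Suc n)" "w' \<in> chains {p} (Suc n)"
        "v = (w + x) + (w' + y)"
      by (auto simp: set_mult_def coset_eq mult_tuple_chains)
    then have "v = (w + w') + (x + y)" by (simp add: algebra_simps)
    then show "v \<in> coset n (x + y)"
      using frag.subspace_add[OF subspace_chains w(1,2)] by (auto simp: coset_eq)
  qed
  show "coset n (x + y) \<subseteq> coset n x <#>\<^bsub>tuple_chains X n\<^esub> coset n y"
  proof
    fix v assume "v \<in> coset n (x + y)"
    then obtain w where w: "w \<in> chains {p} (Suc n)" "v = (w + x) + (0 + y)"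
      by (auto simp: coset_eq add.assoc)
    moreover have "0 \<in> chains {p} (Suc n)"
      by (rule frag.subspace_0[OF subspace_chains])
    ultimately show "v \<in> coset n x <#>\<^bsub>tuple_chains X n\<^esub> coset n y"
      unfolding set_mult_def coset_eq mult_tuple_chains by blast
  qed
qed

lemma collapse_fixes:
  assumes "w \<in> chains {p} l"
  shows "collapse w = w"
  using assms
proof (induction rule: chains_induct)
  case (tuple xs)
  then have "map (\<lambda>x. p) xs = xs" by (intro map_idI) auto
  then show ?case unfolding op_frag_of by (rule arg_cong)
qed (simp_all add: act.zero act.diff)

text \<open>
  The reduced chains meet \<open>C({p})\<close> only in zero, because the collapse is the identity there.
\<close>

lemma coset_inj:
  assumes "x \<in> reduced (Suc n)" "y \<in> reduced (Suc n)" "coset n x = coset n y"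
  shows "x = y"
proof -
  have "0 + x \<in> coset n x"
    unfolding coset_eq using frag.subspace_0[OF subspace_chains] by blast
  then obtain w where w: "w \<in> chains {p} (Suc n)" "x = w + y"
    using assms(3) by (auto simp: coset_eq)
  have "w = collapse (x - y)"
    using w collapse_fixes by simp
  also have "\<dots> = 0"
    using assms(1,2) by (simp add: reduced_def act.diff)
  finally show ?thesis using w(2) by simp
qed

lemma coset_absorb:
  assumes "w \<in> chains {p} (Suc n)"
  shows "coset n (w + z) = coset n z"
proof -
  have "(\<lambda>v. v + w) ` chains {p} (Suc n) = chains {p} (Suc n)"
  proof safe
    show "v + w \<in> chains {p} (Suc n)" if "v \<in> chains {p} (Suc n)" for v
      using that assms by (rule frag.subspace_add[OF subspace_chains])
    show "v \<in> (\<lambda>v. v + w) ` chains {p} (Suc n)" if "v \<in> chains {p} (Suc n)" for v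
      using frag.subspace_diff[OF subspace_chains that assms]
      by (intro image_eqI[of _ _ "v - w"]) auto
  qed
  then have "(\<lambda>v. v + z) ` (\<lambda>v. v + w) ` chains {p} (Suc n) = coset n z"
    by (simp add: coset_eq)
  then show ?thesis
    by (simp add: coset_eq image_image add.assoc)
qed

text \<open>
  Subtracting its collapse makes any representative reduced.
\<close>

lemma carrier_relative_chains: "carrier (relative_chains X p n) = coset n ` reduced (Suc n)"
proof -
  have "coset n c \<in> coset n ` reduced (Suc n)" if c: "c \<in> chains X (Suc n)" for c
  proof -
    have w: "collapse c \<in> chains {p} (Suc n)"
      using act_closed[OF p_in _ c] by simp
    moreover have "chains {p} (Suc n) \<subseteq> chains X (Suc n)"
      using p_in by (auto simp: chains_def tuples_def)
    ultimately have "c - collapse c \<in> reduced (Suc n)"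
      using frag.subspace_diff[OF subspace_chains c] collapse_fixes[OF w]
      by (auto simp: reduced_def act.diff)
    moreover have "coset n (c - collapse c) = coset n c"
      using coset_absorb[OF w, of "c - collapse c"] by simp
    ultimately show ?thesis by (metis imageI)
  qed
  moreover have "carrier (relative_chains X p n) = coset n ` chains X (Suc n)"
    by (simp add: relative_chains_def carrier_FactGroup coset_def[abs_def] carrier_tuple_chains)
  ultimately show ?thesis
    using reduced_chains by auto
qed

lemma one_relative_chains: "\<one>\<^bsub>relative_chains X p n\<^esub> = coset n 0"
  by (simp add: relative_chains_def coset_eq carrier_tuple_chains)

lemma mult_relative_chains:
  "coset n x \<otimes>\<^bsub>relative_chains X p n\<^esub> coset n y = coset n (x + y)"
  by (simp add: relative_chains_def coset_add)

lemma relative_boundary_on_coset: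
  assumes "z \<in> reduced (Suc n)"
  shows "relative_boundary star a b d X p n (coset n z) = coset (n - 1) (total_boundary a b d z)"
  using relative_boundary_coset[of star p a b d X n z] idempotent[OF p_in]
    three_term_boundary_eq[OF assms]
  by (simp add: coset_def)

lemma kernel_relative_boundary:
  "kernel (relative_chains X p n) (relative_chains X p (n - 1)) (relative_boundary star a b d X p n)
    = coset n ` {z \<in> reduced (Suc n). total_boundary a b d z = 0}"
proof -
  have "coset (n - 1) (total_boundary a b d z) = coset (n - 1) 0 \<longleftrightarrow> total_boundary a b d z = 0"
    if z: "z \<in> reduced (Suc n)" for z
  proof (cases n)
    case 0
    then show ?thesis using total_boundary_reduced[OF z] reduced_0 by simp
  next
    case (Suc m)
    have "0 \<in> reduced (Suc m)" by (rule frag.subspace_0[OF subspace_reduced])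
    then show ?thesis
      using total_boundary_reduced[OF z, of a b d] coset_inj[of _ m 0] Suc by auto
  qed
  then show ?thesis
    by (auto simp: kernel_def carrier_relative_chains one_relative_chains relative_boundary_on_coset)
qed

text \<open>
  The isomorphism sends the class of a reduced cycle \<open>z\<close> to the class of its coset \<open>z + C({p})\<close>. It is obtained
  from the surjection \<open>h\<close> of the reduced cycles onto the relative homology, whose kernel are the reduced
  boundaries.
\<close>

theorem relative_homology_iso:
  "relative_homology star a b d X p n \<cong>
    additive_group {z \<in> reduced (Suc n). total_boundary a b d z = 0}
      Mod (total_boundary a b d ` reduced (Suc (Suc n)))"
proof -
  let ?T = "total_boundary a b d"
  let ?Z = "{z \<in> reduced (Suc n). ?T z = 0}" and ?B = "?T ` reduced (Suc (Suc n))"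
  let ?H = "relative_homology star a b d X p n"
  let ?R = "(relative_chains X p n)\<lparr>carrier := coset n ` ?Z\<rparr>"
  interpret total: module_hom frag_cmul frag_cmul "?T" by (rule linear_total_boundary)
  have subB: "frag.subspace ?B"
    by (rule total.subspace_image[OF subspace_reduced])
  have B0: "0 \<in> ?B" using frag.subspace_0[OF subB] .
  have BZ: "?B \<subseteq> ?Z"
    using total_boundary_reduced total_boundary_square_zero by blast
  have H: "?H = ?R Mod (coset n ` ?B)"
  proof -
    have "relative_boundary star a b d X p (Suc n) ` carrier (relative_chains X p (Suc n))
        = coset n ` ?B"
      by (force simp: carrier_relative_chains relative_boundary_on_coset)
    then show ?thesis
      unfolding relative_homology_def kernel_relative_boundary by simp
  qed
  define h where "h z = coset n ` (\<lambda>b. b + z) ` ?B" for z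
  have r_coset: "coset n ` ?B #>\<^bsub>?R\<^esub> coset n z = h z" for z
    by (auto simp: r_coset_def h_def mult_relative_chains)
  have carrier_H: "h ` ?Z = carrier ?H"
    unfolding H carrier_FactGroup using r_coset by (simp add: image_image)
  have one_H: "h 0 = \<one>\<^bsub>?H\<^esub>"
    unfolding H by (simp add: h_def)
  have mult_H: "h x \<otimes>\<^bsub>?H\<^esub> h y = h (x + y)" for x y
  proof
    show "h x \<otimes>\<^bsub>?H\<^esub> h y \<subseteq> h (x + y)"
    proof
      fix v assume "v \<in> h x \<otimes>\<^bsub>?H\<^esub> h y"
      then obtain b1 b2 where b: "b1 \<in> ?B" "b2 \<in> ?B" "v = coset n ((b1 + x) + (b2 + y))"
        unfolding H by (auto simp: set_mult_def h_def mult_relative_chains)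
      then have "v = coset n ((b1 + b2) + (x + y))" by (simp add: algebra_simps)
      then show "v \<in> h (x + y)"
        unfolding h_def using frag.subspace_add[OF subB b(1,2)] by blast
    qed
    show "h (x + y) \<subseteq> h x \<otimes>\<^bsub>?H\<^esub> h y"
    proof
      fix v assume "v \<in> h (x + y)"
      then obtain b1 where b: "b1 \<in> ?B" "v = coset n (b1 + (x + y))"
        by (auto simp: h_def)
      then have "v = coset n (b1 + x) \<otimes>\<^bsub>relative_chains X p n\<^esub> coset n (0 + y)"
        by (simp add: mult_relative_chains add.assoc)
      moreover have "coset n (b1 + x) \<in> h x" "coset n (0 + y) \<in> h y"
        unfolding h_def using b(1) B0 by blast+
      moreover have "h x \<otimes>\<^bsub>?H\<^esub> h y
          = (\<Union>A\<in>h x. \<Union>A'\<in>h y. {A \<otimes>\<^bsub>relative_chains X p n\<^esub> A'})"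
        by (simp add: H set_mult_def)
      ultimately show "v \<in> h x \<otimes>\<^bsub>?H\<^esub> h y" by blast
    qed
  qed
  have Z: "frag.subspace ?Z"
    by (rule frag.subspace_kernel_in[OF linear_total_boundary subspace_reduced])
  let ?G = "additive_group ?Z"
  have G: "group ?G" using Z by (rule frag.group_additive_group)
  have hom: "h \<in> hom ?G ?H"
    using carrier_H mult_H by (intro homI) auto
  have "kernel ?G ?H h = ?B"
  proof safe
    fix z assume "z \<in> kernel ?G ?H h"
    then have z: "z \<in> ?Z" "h z = h 0" by (auto simp: kernel_def one_H)
    have "coset n (0 + z) \<in> h z" unfolding h_def using B0 by blast
    then obtain b where b: "b \<in> ?B" "coset n z = coset n b"
      using z(2) by (auto simp: h_def)
    then have "z = b" using coset_inj z(1) BZ by blast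
    then show "z \<in> ?B" using b(1) by simp
  next
    fix z assume "z \<in> reduced (Suc (Suc n))"
    then have z: "?T z \<in> ?B" by blast
    have "(\<lambda>b. b + ?T z) ` ?B = ?B"
    proof safe
      fix b assume "b \<in> reduced (Suc (Suc n))"
      then show "?T b + ?T z \<in> ?B" using frag.subspace_add[OF subB _ z] by blast
      then have "?T b - ?T z \<in> ?B"
        using \<open>b \<in> reduced (Suc (Suc n))\<close> frag.subspace_diff[OF subB _ z] by blast
      then show "?T b \<in> (\<lambda>b. b + ?T z) ` ?B"
        by (rule rev_image_eqI) simp
    qed
    then have "h (?T z) = h 0" by (simp add: h_def)
    then show "?T z \<in> kernel ?G ?H h"
      using z BZ by (auto simp: kernel_def one_H)
  qed
  then have "?G Mod ?B \<cong> ?H"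
    using Mod_kernel_iso_of_surj(2)[OF G hom] carrier_H one_H by simp
  moreover have "group (?G Mod ?B)"
  proof -
    have "comm_group ?G"
      using G by (rule group.group_comm_groupI) (simp add: add.commute)
    moreover have "subgroup ?B ?G"
      using \<open>kernel ?G ?H h = ?B\<close> Mod_kernel_iso_of_surj(1)[OF G hom] carrier_H one_H
        group_hom.subgroup_kernel[of ?G ?H h] G hom
      by (simp add: group_hom_def group_hom_axioms_def)
    ultimately show ?thesis
      using comm_group.abelian_FactGroup comm_group.axioms(2) by blast
  qed
  ultimately show ?thesis
    by (rule group.iso_sym[rotated])
qed

end

section \<open>Ranks and the homology groups\<close>

lemma r_exponent_0: "k \<ge> 1 \<Longrightarrow> r_exponent 0 k = 1"
  by (simp add: r_exponent_def add.commute)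

lemma r_exponent_Suc:
  assumes "k \<ge> 1"
  shows "r_exponent (Suc n) k + r_exponent n k = k ^ Suc n"
proof -
  have nz: "(1 + of_nat k :: rat) \<noteq> 0"
    using of_nat_neq_0[of k, where 'a = rat] by simp
  have r: "of_nat (r_exponent m k) * (1 + of_nat k) = (of_nat k ^ (m + 1) + (-1) ^ m :: rat)" for m
    using nz by (simp add: of_nat_r_exponent[OF assms])
  have "(of_nat (r_exponent (Suc n) k + r_exponent n k) :: rat) * (1 + of_nat k)
      = of_nat (k ^ Suc n) * (1 + of_nat k)"
    unfolding of_nat_add distrib_right[of _ _ "1 + of_nat k"] r by (simp add: algebra_simps)
  then have "(of_nat (r_exponent (Suc n) k + r_exponent n k) :: rat) = of_nat (k ^ Suc n)"
    by (rule iffD1[OF mult_right_cancel[OF nz]])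
  then show ?thesis
    by (simp only: of_nat_eq_iff)
qed

lemma DirProd_group_power_0: "G \<times>\<times> group_power H 0 \<cong> G"
proof -
  have "fst \<in> iso (G \<times>\<times> group_power H 0) G"
    by (auto simp: iso_def hom_def DirProd_def group_power_def bij_betw_def inj_on_def image_def)
  then show ?thesis unfolding is_iso_def by blast
qed

lemma Zmod_0: "Zmod 0 = integer_group"
  by (simp add: Zmod_def integer_mod_group_def)

context projector_unit_spindle
begin

interpretation R: retracted_complex frag_cmul reduced bdR dup_op tl_op
  by (rule retracted_complex_reduced)

lemma card_X: "card X \<ge> 1"
  using finite_X p_in card_gt_0_iff[of X] by fastforce

text \<open>
  Both sides satisfy the same two-term recursion. The parity term stems from the \<open>- 1\<close> in the rank of the
  reduced chains.
\<close>

lemma rank_bdR_image: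
  "frag.rank (bdR ` reduced (Suc (Suc n))) + of_bool (even n) = r_exponent n (card X)"
proof (induction n)
  case 0
  have "frag.rank (reduced 0) = 0" by (simp add: reduced_0)
  then show ?case
    using R.rank_D_image_add[of 0] card_X by (simp add: r_exponent_0)
next
  case (Suc n)
  have "frag.rank (bdR ` reduced (Suc (Suc (Suc n)))) + frag.rank (bdR ` reduced (Suc (Suc n))) + 1
      = card X ^ Suc n"
    using R.rank_D_image_add[of "Suc n"] rank_reduced[of "Suc n"] by simp
  then show ?case
    using Suc r_exponent_Suc[OF card_X, of n] by (cases "even n") simp_all
qed

lemma homology_iso_of_basis:
  assumes "frag.basis_of {z \<in> reduced (Suc n). total_boundary a b d z = 0} (P \<union> Q)" "P \<inter> Q = {}"
    and "total_boundary a b d ` reduced (Suc (Suc n))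
      = frag.span (frag_cmul m ` P \<union> frag_cmul k ` Q)"
  shows "relative_homology star a b d X p n
    \<cong> group_power (Zmod m) (card P) \<times>\<times> group_power (Zmod k) (card Q)"
proof (rule iso_trans[OF relative_homology_iso])
  show "additive_group {z \<in> reduced (Suc n). total_boundary a b d z = 0}
      Mod (total_boundary a b d ` reduced (Suc (Suc n)))
    \<cong> group_power (Zmod m) (card P) \<times>\<times> group_power (Zmod k) (card Q)"
    unfolding assms(3) by (rule frag.quotient_by_scaled_basis[OF assms(1,2)])
qed

text \<open>
  \<open>\<int>\<close> is \<open>Zmod 0\<close>, and the empty second factor is trivial, so this is an instance of the general shape.
\<close>

lemma homology_all_zero:
  "relative_homology star 0 0 0 X p n \<cong> group_power integer_group (card X ^ (n + 1) - 1)"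
proof -
  have t0: "total_boundary 0 0 0 z = 0" for z by (simp add: total_boundary_def)
  obtain B where B: "frag.basis_of (reduced (Suc n)) B" using reduced_has_basis by blast
  have "relative_homology star 0 0 0 X p n
      \<cong> group_power (Zmod 0) (card B) \<times>\<times> group_power (Zmod 1) (card ({} :: ('a list \<Rightarrow>\<^sub>0 int) set))"
  proof (rule homology_iso_of_basis)
    have "frag.span (frag_cmul 0 ` B \<union> frag_cmul 1 ` {}) \<subseteq> {0}"
      by (rule frag.span_minimal) auto
    then show "total_boundary 0 0 0 ` reduced (Suc (Suc n))
        = frag.span (frag_cmul 0 ` B \<union> frag_cmul 1 ` {})"
      using t0 frag.subspace_0[OF subspace_reduced] frag.span_zero by (auto simp: image_def)
  qed (use B t0 in auto)
  moreover have "card B = card X ^ (n + 1) - 1"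
    using frag.rank_eq_card[OF B] rank_reduced[of "Suc n"] by simp
  ultimately have "relative_homology star 0 0 0 X p n
      \<cong> group_power integer_group (card X ^ (n + 1) - 1) \<times>\<times> group_power (Zmod 1) 0"
    by (simp add: Zmod_0)
  then show ?thesis
    by (rule iso_trans[OF _ DirProd_group_power_0])
qed

text \<open>
  A factor \<open>d \<noteq> 0\<close> keeps the cycles of \<open>\<partial>\<^sub>R\<close> and scales its boundaries, so a basis of the cycles that extends one of
  the boundaries has multipliers \<open>0\<close> and \<open>d\<close>.
\<close>

lemma homology_right_only:
  assumes "d \<noteq> 0"
  shows "relative_homology star 0 0 d X p n
    \<cong> group_power integer_group (card X ^ n * (card X - 1))
      \<times>\<times> group_power (Zmod d) (r_exponent n (card X) - of_bool (even n))"
proof -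
  obtain P Q where PQ: "frag.basis_of {x \<in> reduced (Suc n). bdR x = 0} (P \<union> Q)" "P \<inter> Q = {}"
    "frag.basis_of (bdR ` reduced (Suc (Suc n))) Q"
    "card P + card Q + frag.rank (bdR ` reduced (Suc n)) = frag.rank (reduced (Suc n))"
    by (rule R.kernel_D_basis)
  have t: "total_boundary 0 0 d z = frag_cmul d (bdR z)" for z by (simp add: total_boundary_def)
  have "relative_homology star 0 0 d X p n
      \<cong> group_power (Zmod 0) (card P) \<times>\<times> group_power (Zmod d) (card Q)"
  proof (rule homology_iso_of_basis)
    show "frag.basis_of {z \<in> reduced (Suc n). total_boundary 0 0 d z = 0} (P \<union> Q)"
      using PQ(1) assms by (simp add: t)
    have "frag.basis_of (frag_cmul d ` bdR ` reduced (Suc (Suc n))) (frag_cmul d ` Q)"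
      using frag.basis_of_scale[OF PQ(3) assms] .
    then have "total_boundary 0 0 d ` reduced (Suc (Suc n)) = frag.span (frag_cmul d ` Q)"
      by (simp add: frag.basis_of_def t image_image)
    moreover have "frag.span (frag_cmul 0 ` P \<union> frag_cmul d ` Q) = frag.span (frag_cmul d ` Q)"
    proof (rule antisym)
      show "frag.span (frag_cmul 0 ` P \<union> frag_cmul d ` Q) \<subseteq> frag.span (frag_cmul d ` Q)"
        by (rule frag.span_minimal) (auto simp: frag.span_zero intro: frag.span_base)
      show "frag.span (frag_cmul d ` Q) \<subseteq> frag.span (frag_cmul 0 ` P \<union> frag_cmul d ` Q)"
        by (rule frag.span_mono) blast
    qed
    ultimately show "total_boundary 0 0 d ` reduced (Suc (Suc n))
        = frag.span (frag_cmul 0 ` P \<union> frag_cmul d ` Q)" by simp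
  qed (rule PQ(2))
  moreover have cQ: "card Q = frag.rank (bdR ` reduced (Suc (Suc n)))"
    using frag.rank_eq_card[OF PQ(3)] by simp
  then have "card Q = r_exponent n (card X) - of_bool (even n)"
    using rank_bdR_image[of n] by simp
  moreover have "card P = card X ^ n * (card X - 1)"
  proof -
    have "card P + card X ^ n = card X ^ Suc n"
      using PQ(4) cQ R.rank_D_image_add[of n] rank_reduced[of n] rank_reduced[of "Suc n"] by linarith
    then show ?thesis
      by (simp add: diff_mult_distrib2 mult.commute)
  qed
  ultimately show ?thesis
    by (simp add: Zmod_0)
qed

lemma homology_gcd_nonzero:
  assumes g: "gcd a b \<noteq> 0"
  shows "relative_homology star a b d X p n
    \<cong> group_power (Zmod (gcd a b)) ((card X - 1) * r_exponent n (card X))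
      \<times>\<times> group_power (Zmod (gcd a (gcd b d))) (r_exponent n (card X) - of_bool (even n))"
proof -
  let ?g = "gcd a b"
  obtain \<alpha> \<beta> where "\<alpha> * a + \<beta> * b = ?g"
    using bezout_int by blast
  then have "?g * (\<alpha> * (a div ?g) + \<beta> * (b div ?g)) = ?g * 1"
    by (simp add: distrib_left mult.left_commute)
  then have ab: "\<alpha> * (a div ?g) + \<beta> * (b div ?g) = 1"
    by (rule iffD1[OF mult_left_cancel[OF g]])
  define \<delta> where "\<delta> = (\<lambda>c. frag_cmul (a div ?g) (bdL c) + frag_cmul (b div ?g) (bdS c))"
  define s where "s = (\<lambda>c. frag_cmul (\<alpha> - \<beta>) (append_op p c) + frag_cmul \<beta> (append_op u c))"
  interpret W: weighted_complex frag_cmul reduced bdR dup_op tl_op \<delta> s ?g d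
    unfolding \<delta>_def s_def
    by (intro weighted_complex.intro contracted_complex_reduced ab)
  have t: "W.total = total_boundary a b d"
    unfolding W.total_def total_boundary_def by (rule ext) (simp add: \<delta>_def frag_cmul_distrib2)
  have G: "W.G = gcd a (gcd b d)"
    by (simp add: W.G_def gcd.assoc)
  obtain P Q where PQ: "frag.basis_of {x \<in> reduced (Suc n). total_boundary a b d x = 0} (P \<union> Q)"
    "P \<inter> Q = {}"
    "total_boundary a b d ` reduced (Suc (Suc n))
      = frag.span (frag_cmul ?g ` P \<union> frag_cmul (gcd a (gcd b d)) ` Q)"
    "card Q = frag.rank (bdR ` reduced (Suc (Suc n)))" "card P + card Q = frag.rank (W.K (Suc n))"
    using W.total_cycles_basis[OF g, of n] unfolding t G by blast
  have rank_K: "frag.rank (W.K (Suc m)) = (card X - 1) * r_exponent m (card X)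
      + frag.rank (bdR ` reduced (Suc (Suc m)))" for m
  proof (induction m)
    case 0
    have "frag.rank (W.K (Suc 0)) = card X - 1"
      using W.rank_K_add[of 0] rank_reduced[of "Suc 0"] by (simp add: W.K_0)
    then show ?case
      using rank_bdR_image[of 0] r_exponent_0[OF card_X] by simp
  next
    case (Suc m)
    let ?k = "card X" and ?E = "\<lambda>m. frag.rank (bdR ` reduced (Suc (Suc m)))"
    obtain j where j: "?k = Suc j" using card_X by (cases ?k) auto
    have "frag.rank (W.K (Suc (Suc m))) + frag.rank (W.K (Suc m)) + 1 = Suc j * ?k ^ Suc m"
      using W.rank_K_add[of "Suc m"] rank_reduced[of "Suc (Suc m)"] j by simp
    moreover have "?E (Suc m) + ?E m + 1 = ?k ^ Suc m"
      using R.rank_D_image_add[of "Suc m"] rank_reduced[of "Suc m"] by simp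
    moreover have "j * r_exponent (Suc m) ?k + j * r_exponent m ?k = j * ?k ^ Suc m"
      using r_exponent_Suc[OF card_X, of m] by (simp only: flip: distrib_left)
    ultimately show ?case
      using Suc j by simp
  qed
  have "card P = (card X - 1) * r_exponent n (card X)"
    using PQ(4,5) rank_K by simp
  moreover have "card Q = r_exponent n (card X) - of_bool (even n)"
    using PQ(4) rank_bdR_image[of n] by simp
  ultimately show ?thesis
    using homology_iso_of_basis[OF PQ(1-3)] by simp
qed

end

theorem proposition6p3:
  fixes X :: "'a set" and star :: "'a \<Rightarrow> 'a \<Rightarrow> 'a" and p0 u :: 'a
    and a b d :: int and n :: nat
  assumes "spindle X star" and "finite X"
    and "p0 \<in> X" and "\<forall>x\<in>X. star x p0 = p0"
    and "u \<in> X" and "\<forall>x\<in>X. star x u = x"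
  shows
    "let g = gcd a b; \<Sigma> = a + b + d; k = card X;
         r = r_exponent n k; e = r - of_bool (odd (n + 1));
         H = relative_homology star a b d X p0 n
     in (\<Sigma> = 0 \<and> g = 0 \<longrightarrow> H \<cong> group_power integer_group (k ^ (n + 1) - 1))
      \<and> (\<Sigma> \<noteq> 0 \<and> g = 0 \<longrightarrow>
           H \<cong> group_power integer_group (k ^ n * (k - 1)) \<times>\<times> group_power (Zmod \<Sigma>) e)
      \<and> (\<Sigma> = 0 \<and> g \<noteq> 0 \<longrightarrow>
           H \<cong> group_power (Zmod g) ((k - 1) * r) \<times>\<times> group_power (Zmod (gcd a (gcd b d))) e)
      \<and> (\<Sigma> \<noteq> 0 \<and> g \<noteq> 0 \<longrightarrow>
           H \<cong> group_power (Zmod g) ((k - 1) * r) \<times>\<times> group_power (Zmod (gcd a (gcd b d))) e)"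
proof -
  interpret projector_unit_spindle X star p0 u
    using assms by (simp add: projector_unit_spindle_def projector_unit_spindle_axioms_def)
  show ?thesis
    unfolding Let_def
    using homology_all_zero[of n] homology_right_only[of d n] homology_gcd_nonzero[of a b d n]
    by (cases "a = 0 \<and> b = 0") auto
qed

end
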